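(* There exists a minimizer of $E$ in $\mathcal{A}_{ncb}$. Furthermore it is unique and equals $u(x)=\lambda x+b$.
   Context: $\Omega\subset\mathbb{R}^3$ is a smooth bounded domain (not necessarily axisymmetric), and $\tilde\Omega\subset\mathbb{R}^3$ is a smooth bounded domain with $\overline\Omega\subset\tilde\Omega$. $H:(0,\infty)\to[0,\infty)$ is a (smooth) convex function with $\lim_{t\to+\infty}H(t)/t=\lim_{s\to0^+}H(s)=+\infty$, and $E(u)=\int_\Omega|Du|^2+H(\det Du)\,dx$. Let $M>0$, $\lambda\in\mathbb{R}$, $b\in\mathbb{R}^3$ and $g(x)=\lambda x+b$; $g$ is assumed orientation preserving, i.e. $\lambda>0$, and $\|g\|_{L^\infty(\Omega)}\le M$. $\mathcal{A}$ is the set of $u\in W^{1,2}\cap L^\infty(\Omega,\mathbb{R}^3)$ with $u|_{\partial\Omega}=g|_{\partial\Omega}$, $\|u\|_\infty\le M$, $\det Du>0$ a.e. and $u$ one-to-one a.e. (injective outside a Lebesgue-null set). For $u\in\mathcal{A}$ its extension $u^e\in W^{1,2}(\tilde\Omega,\mathbb{R}^3)$ is $u^e=u$ in $\Omega$ and $u^e=g$ in $\tilde\Omega\setminus\Omega$. For $w\in W^{1,2}(\tilde\Omega,\mathbb{R}^3)$ with $\det Dw\in L^1(\tilde\Omega)$, $$\mathcal{E}_{\tilde\Omega}(w)=\sup\Big\{\int_{\tilde\Omega}\langle\operatorname{cof}Dw,D_xf(x,w(x))\rangle+\det Dw\,\operatorname{div}_yf(x,w(x))\,dx:\ f\in C^1_c(\tilde\Omega\times\mathbb{R}^3,\mathbb{R}^3),\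 \|f\|_\infty\le1\Big\},$$ where $\langle A,B\rangle=\operatorname{tr}(A^TB)$ and $A^T\operatorname{cof}A=(\det A)I$. Finally $\mathcal{A}_{ncb}=\{v\in\mathcal{A}:\mathcal{E}_{\tilde\Omega}(v^e)=0\}$. *)

theory Defs
  imports "HOL-Analysis.Analysis" "HOL-Probability.Essential_Supremum"
begin

text \<open>
  A map on an open set \<open>\<Omega>\<close> is a total function on \<open>real^3\<close> whose values outside \<open>\<Omega>\<close> play no role.
\<close>

subsection \<open>Smooth functions and smooth domains\<close>

text \<open>
  \<open>Ck_on k f S\<close> is meant for open \<open>S\<close> in a finite-dimensional space: \<open>f\<close> is differentiable and all
  its directional derivatives are of class \<open>C\<^sup>k\<^sup>-\<^sup>1\<close>; this is the usual class \<open>C\<^sup>k\<close>.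
\<close>

primrec Ck_on :: "nat \<Rightarrow> ('a::real_normed_vector \<Rightarrow> 'b::real_normed_vector) \<Rightarrow> 'a set \<Rightarrow> bool" where
  "Ck_on 0 f S \<longleftrightarrow> continuous_on S f"
| "Ck_on (Suc k) f S \<longleftrightarrow>
     (\<forall>x\<in>S. f differentiable (at x)) \<and> (\<forall>v. Ck_on k (\<lambda>x. frechet_derivative f (at x) v) S)"

definition smooth_fun_on :: "('a::real_normed_vector \<Rightarrow> 'b::real_normed_vector) \<Rightarrow> 'a set \<Rightarrow> bool" where
  "smooth_fun_on f S \<longleftrightarrow> (\<forall>k. Ck_on k f S)"

text \<open>Smoothness of the boundary is expressed by local defining functions with nonvanishing derivative.\<close>

definition smooth_bounded_domain :: "(real^3) set \<Rightarrow> bool" where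
  "smooth_bounded_domain \<Omega> \<longleftrightarrow>
     open \<Omega> \<and> connected \<Omega> \<and> bounded \<Omega> \<and> \<Omega> \<noteq> {} \<and>
     (\<forall>p\<in>frontier \<Omega>. \<exists>U (\<rho> :: real^3 \<Rightarrow> real).
        open U \<and> p \<in> U \<and> smooth_fun_on \<rho> U \<and>
        (\<forall>x\<in>U. frechet_derivative \<rho> (at x) \<noteq> (\<lambda>_. 0)) \<and>
        \<Omega> \<inter> U = {x\<in>U. \<rho> x < 0})"

definition supp :: "('a::topological_space \<Rightarrow> 'b::zero) \<Rightarrow> 'a set" where
  "supp f = closure {x. f x \<noteq> 0}"

text \<open>
  The spaces \<open>C\<^sub>c\<^sup>\<infinity>(\<Omega>)\<close> and \<open>C\<^sub>c\<^sup>1(\<Omega>)\<close>; functions with compact support in the open set \<open>\<Omega>\<close> are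
  identified with their extensions by zero.
\<close>

definition smooth_compact :: "'a set \<Rightarrow> ('a::real_normed_vector \<Rightarrow> 'b::real_normed_vector) set" where
  "smooth_compact \<Omega> = {\<phi>. smooth_fun_on \<phi> UNIV \<and> compact (supp \<phi>) \<and> supp \<phi> \<subseteq> \<Omega>}"

definition C1_compact :: "'a set \<Rightarrow> ('a::real_normed_vector \<Rightarrow> 'b::real_normed_vector) set" where
  "C1_compact \<Omega> = {f. Ck_on 1 f UNIV \<and> compact (supp f) \<and> supp f \<subseteq> \<Omega>}"

subsection \<open>Sobolev maps\<close>

definition locally_integrable :: "(real^3) set \<Rightarrow> (real^3 \<Rightarrow> 'b::euclidean_space) \<Rightarrow> bool" where
  "locally_integrable \<Omega> f \<longleftrightarrow> (\<forall>K. compact K \<and> K \<subseteq> \<Omega> \<longrightarrow> f absolutely_integrable_on K)"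

text \<open>
  The entry \<open>G x $ i $ j\<close> is the weak derivative of the \<open>i\<close>-th component in direction \<open>j\<close>, the same
  convention as for the library's \<open>jacobian\<close>.
\<close>

definition has_weak_derivative :: "(real^3) set \<Rightarrow> (real^3 \<Rightarrow> real^3) \<Rightarrow> (real^3 \<Rightarrow> real^3^3) \<Rightarrow> bool" where
  "has_weak_derivative \<Omega> u G \<longleftrightarrow>
     locally_integrable \<Omega> u \<and> locally_integrable \<Omega> G \<and>
     (\<forall>\<phi> \<in> smooth_compact \<Omega>. \<forall>i j.
        (LINT x|lebesgue_on \<Omega>. u x $ i * frechet_derivative \<phi> (at x) (axis j 1)) =
        - (LINT x|lebesgue_on \<Omega>. G x $ i $ j * \<phi> x))"

text \<open>
  A weak derivative is unique up to a null set, so every expression below that involves \<open>weak_D \<Omega> u\<close>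
  with \<open>u\<close> weakly differentiable is independent of the choice.
\<close>

definition weak_D :: "(real^3) set \<Rightarrow> (real^3 \<Rightarrow> real^3) \<Rightarrow> real^3 \<Rightarrow> real^3^3" where
  "weak_D \<Omega> u = (SOME G. has_weak_derivative \<Omega> u G)"

definition square_integrable :: "(real^3) set \<Rightarrow> (real^3 \<Rightarrow> 'b::euclidean_space) \<Rightarrow> bool" where
  "square_integrable \<Omega> f \<longleftrightarrow>
     f \<in> borel_measurable (lebesgue_on \<Omega>) \<and> integrable (lebesgue_on \<Omega>) (\<lambda>x. (norm (f x))\<^sup>2)"

definition W12 :: "(real^3) set \<Rightarrow> (real^3 \<Rightarrow> real^3) set" where
  "W12 \<Omega> = {u. square_integrable \<Omega> u \<and> (\<exists>G. has_weak_derivative \<Omega> u G) \<and>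
                square_integrable \<Omega> (weak_D \<Omega> u)}"

definition W12_norm :: "(real^3) set \<Rightarrow> (real^3 \<Rightarrow> real^3) \<Rightarrow> real" where
  "W12_norm \<Omega> u = sqrt ((LINT x|lebesgue_on \<Omega>. (norm (u x))\<^sup>2) +
                        (LINT x|lebesgue_on \<Omega>. (norm (weak_D \<Omega> u x))\<^sup>2))"

text \<open>The closure of \<open>C\<^sub>c\<^sup>\<infinity>(\<Omega>)\<close> in \<open>W\<^sup>1\<^sup>,\<^sup>2(\<Omega>)\<close>.\<close>

definition W12_0 :: "(real^3) set \<Rightarrow> (real^3 \<Rightarrow> real^3) set" where
  "W12_0 \<Omega> = {u \<in> W12 \<Omega>. \<exists>\<phi> :: nat \<Rightarrow> real^3 \<Rightarrow> real^3.
       (\<forall>k. \<phi> k \<in> smooth_compact \<Omega>) \<and> (\<lambda>k. W12_norm \<Omega> (\<lambda>x. \<phi> k x - u x)) \<longlonglongrightarrow> 0}"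

text \<open>Equality of boundary values of Sobolev maps on a smooth bounded domain.\<close>

definition same_boundary_values :: "(real^3) set \<Rightarrow> (real^3 \<Rightarrow> real^3) \<Rightarrow> (real^3 \<Rightarrow> real^3) \<Rightarrow> bool" where
  "same_boundary_values \<Omega> u g \<longleftrightarrow> (\<lambda>x. u x - g x) \<in> W12_0 \<Omega>"

definition Linf_norm :: "(real^3) set \<Rightarrow> (real^3 \<Rightarrow> real^3) \<Rightarrow> ereal" where
  "Linf_norm \<Omega> u = esssup (lebesgue_on \<Omega>) (\<lambda>x. ereal (norm (u x)))"

subsection \<open>The energy and the admissible classes\<close>

text \<open>
  The norm on \<open>real^3^3\<close> is the Frobenius norm. The energy is extended-valued; on admissible maps the
  determinant is positive almost everywhere, so values of \<open>H\<close> outside \<open>(0,\<infinity>)\<close> do not matter.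
\<close>

definition energy :: "(real \<Rightarrow> real) \<Rightarrow> (real^3) set \<Rightarrow> (real^3 \<Rightarrow> real^3) \<Rightarrow> ennreal" where
  "energy H \<Omega> u =
     (\<integral>\<^sup>+ x. ennreal ((norm (weak_D \<Omega> u x))\<^sup>2 + H (det (weak_D \<Omega> u x))) \<partial>lebesgue_on \<Omega>)"

definition injective_ae :: "(real^3) set \<Rightarrow> (real^3 \<Rightarrow> real^3) \<Rightarrow> bool" where
  "injective_ae \<Omega> u \<longleftrightarrow> (\<exists>N. negligible N \<and> inj_on u (\<Omega> - N))"

definition admissible :: "(real^3) set \<Rightarrow> (real^3 \<Rightarrow> real^3) \<Rightarrow> real \<Rightarrow> (real^3 \<Rightarrow> real^3) set" where
  "admissible \<Omega> g M = {u \<in> W12 \<Omega>.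
      same_boundary_values \<Omega> u g \<and>
      Linf_norm \<Omega> u \<le> ereal M \<and>
      (AE x in lebesgue_on \<Omega>. det (weak_D \<Omega> u x) > 0) \<and>
      injective_ae \<Omega> u}"

definition extend_by :: "(real^3) set \<Rightarrow> (real^3 \<Rightarrow> real^3) \<Rightarrow> (real^3 \<Rightarrow> real^3) \<Rightarrow> real^3 \<Rightarrow> real^3" where
  "extend_by \<Omega> g u x = (if x \<in> \<Omega> then u x else g x)"

text \<open>
  The \<open>(i,j)\<close> cofactor is the determinant of \<open>A\<close> with its \<open>i\<close>-th row replaced by the \<open>j\<close>-th
  standard unit vector.
\<close>

definition cof :: "real^3^3 \<Rightarrow> real^3^3" where
  "cof A = (\<chi> i j. det (\<chi> k. if k = i then axis j 1 else A $ k))"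

lemma transpose_mult_cof: "transpose A ** cof A = det A *\<^sub>R mat 1"
  by (simp add: vec_eq_iff matrix_matrix_mult_def transpose_def cof_def det_3 sum_3 mat_def
      axis_def forall_3 algebra_simps)

text \<open>
  The Lebesgue integral below is meant for \<open>det Dw\<close> integrable on \<open>T\<close> (the integrand is then
  integrable for \<open>w\<close> in \<open>W\<^sup>1\<^sup>,\<^sup>2\<close>). This holds for the extension of every admissible map, since by the
  area formula the integral of \<open>det Du\<close> is at most the volume of the ball of radius \<open>M\<close>.
\<close>

definition surface_energy :: "(real^3) set \<Rightarrow> (real^3 \<Rightarrow> real^3) \<Rightarrow> ereal" where
  "surface_energy T w =
     (SUP f \<in> {f \<in> C1_compact (T \<times> UNIV). \<forall>z. norm (f z) \<le> 1}.
        ereal (LINT x|lebesgue_on T.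
          trace (transpose (cof (weak_D T w x)) ** jacobian (\<lambda>x'. f (x', w x)) (at x)) +
          det (weak_D T w x) * trace (jacobian (\<lambda>y. f (x, y)) (at (w x)))))"

definition admissible_ncb ::
  "(real^3) set \<Rightarrow> (real^3) set \<Rightarrow> (real^3 \<Rightarrow> real^3) \<Rightarrow> real \<Rightarrow> (real^3 \<Rightarrow> real^3) set" where
  "admissible_ncb \<Omega> T g M =
     {v \<in> admissible \<Omega> g M. surface_energy T (extend_by \<Omega> g v) = 0}"

end

theory Submission
  imports Defs "HOL-Real_Asymp.Real_Asymp"
begin

text \<open>
  Write \<open>u = g + v\<close> with \<open>v \<in> W\<^sub>0\<^sup>1\<^sup>,\<^sup>2(\<Omega>)\<close>. Since \<open>Dv\<close> has mean zero,
  \<open>\<integral>|Du|\<^sup>2 = \<integral>|Dg|\<^sup>2 + \<integral>|Dv|\<^sup>2\<close>. Testing the vanishing surface energy with \<open>f (x, y) = y\<close>, suitably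
  cut off, shows that \<open>det Du\<close> has mean \<open>\<lambda>\<^sup>3\<close>, so by the tangent line of the convex function
  \<open>H\<close> at \<open>\<lambda>\<^sup>3\<close> also \<open>\<integral>H(det Du) \<ge> \<integral>H(det Dg)\<close>. Hence \<open>E(u) \<ge> E(g) + \<integral>|Dv|\<^sup>2\<close>, and equality
  forces \<open>Dv = 0\<close> and, by the Poincare inequality, \<open>v = 0\<close>. No area formula is needed for the
  integrability of \<open>det Du\<close>: a map of finite energy has it by the superlinear growth of \<open>H\<close>.
\<close>

subsection \<open>Functions of class C^k and smooth bumps\<close>

text \<open>The gradient of \<open>g\<close> is a constant multiple of the identity, so besides
  \<open>|Dv|^2\<close> the energy gap involves only quantities whose mean has to be known:
  \<open>trace Dv\<close> and \<open>det Du\<close>. The second is the obstacle. In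
  \<open>W12\<close> volume may be created by cavitation, so boundary values alone do not fix the
  mean of the determinant; the vanishing surface energy does. The energy is a supremum over a unit
  ball of a functional linear in the test field, so the value zero makes the functional itself
  vanish. The field \<open>y\<close> is cut off in \<open>x\<close> within the larger domain
  \<open>T\<close>: the cutoff is then \<open>1\<close> on all of \<open>\<Omega>\<close>, and its
  gradient lives only where the extension of \<open>u\<close> equals \<open>g\<close>. There all
  terms cancel against those of \<open>g\<close>, whose surface energy vanishes too. Two features of
  the encoding shape the rest. \<open>weak_D\<close> is a choice, so identities hold only almost
  everywhere and rest on uniqueness of weak derivatives; this is where smooth bumps enter. And the
  integral of a non-integrable function is \<open>0\<close>, so integrability has to be proved
  before an integral is split.\<close>

lemma Ck_on_Suc_UNIV_I:
  assumes "\<And>x. (f has_derivative f' x) (at x)" and "\<And>v. Ck_on k (\<lambda>x. f' x v) UNIV"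
  shows "Ck_on (Suc k) f UNIV"
proof -
  have "frechet_derivative f (at x) = f' x" for x
    by (rule frechet_derivative_at[OF assms(1), symmetric])
  then have eq: "(\<lambda>x. frechet_derivative f (at x) v) = (\<lambda>x. f' x v)" for v
    by simp
  show ?thesis
    unfolding Ck_on.simps eq using assms(2) differentiableI[OF assms(1)] by blast
qed

lemma Ck_on_Suc_UNIV_D:
  assumes "Ck_on (Suc k) f UNIV"
  shows "(f has_derivative frechet_derivative f (at x)) (at x)"
    and "Ck_on k (\<lambda>x. frechet_derivative f (at x) v) UNIV"
  using assms by (simp_all add: frechet_derivative_works[symmetric])

lemma Ck_on_Suc_imp: "Ck_on (Suc k) f UNIV \<Longrightarrow> Ck_on k f UNIV"
proof (induction k arbitrary: f)
  case 0
  then show ?case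
    by (auto intro!: continuous_at_imp_continuous_on differentiable_imp_continuous_within)
next
  case (Suc k)
  then show ?case by simp
qed

lemma Ck_on_const: "Ck_on k (\<lambda>x. c) UNIV"
proof (induction k arbitrary: c)
  case (Suc k)
  show ?case by (rule Ck_on_Suc_UNIV_I[where f'="\<lambda>x v. 0"]) (auto simp: Suc)
qed simp

lemma Ck_on_add:
  assumes "Ck_on k f UNIV" "Ck_on k g UNIV"
  shows "Ck_on k (\<lambda>x. f x + g x) UNIV"
  using assms
proof (induction k arbitrary: f g)
  case 0
  then show ?case by (auto intro: continuous_on_add)
next
  case (Suc k)
  note f = Ck_on_Suc_UNIV_D[OF Suc.prems(1)] and g = Ck_on_Suc_UNIV_D[OF Suc.prems(2)]
  show ?case
    by (rule Ck_on_Suc_UNIV_I[OF has_derivative_add[OF f(1) g(1)]]) (rule Suc.IH[OF f(2) g(2)])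
qed

lemma Ck_on_sum:
  assumes "\<And>i. i \<in> I \<Longrightarrow> Ck_on k (f i) UNIV"
  shows "Ck_on k (\<lambda>x. \<Sum>i\<in>I. f i x) UNIV"
  using assms
  by (induction I rule: infinite_finite_induct) (auto intro!: Ck_on_const Ck_on_add)

lemma Ck_on_scaleR:
  assumes "Ck_on k f UNIV" "Ck_on k g UNIV"
  shows "Ck_on k (\<lambda>x. f x *\<^sub>R g x) UNIV"
  using assms
proof (induction k arbitrary: f g)
  case 0
  then show ?case by (auto intro: continuous_on_scaleR)
next
  case (Suc k)
  note f = Ck_on_Suc_UNIV_D[OF Suc.prems(1)] and g = Ck_on_Suc_UNIV_D[OF Suc.prems(2)]
  show ?case
    by (rule Ck_on_Suc_UNIV_I[OF has_derivative_scaleR[OF f(1) g(1)]])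
      (rule Ck_on_add[OF Suc.IH[OF Ck_on_Suc_imp[OF Suc.prems(1)] g(2)]
          Suc.IH[OF f(2) Ck_on_Suc_imp[OF Suc.prems(2)]]])
qed

lemma Ck_on_mult:
  fixes f g :: "'a::real_normed_vector \<Rightarrow> real"
  assumes "Ck_on k f UNIV" "Ck_on k g UNIV"
  shows "Ck_on k (\<lambda>x. f x * g x) UNIV"
  using Ck_on_scaleR[OF assms] by simp

lemma Ck_on_bounded_linear:
  assumes "bounded_linear L"
  shows "Ck_on k L UNIV"
proof (cases k)
  case 0
  then show ?thesis by (simp add: linear_continuous_on assms)
next
  case (Suc m)
  then show ?thesis
    using Ck_on_Suc_UNIV_I[OF bounded_linear_imp_has_derivative[OF assms] Ck_on_const] by simp
qed

lemma Ck_on_prod: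
  fixes f :: "'i \<Rightarrow> 'a::real_normed_vector \<Rightarrow> real"
  assumes "\<And>i. i \<in> I \<Longrightarrow> Ck_on k (f i) UNIV"
  shows "Ck_on k (\<lambda>x. \<Prod>i\<in>I. f i x) UNIV"
  using assms
  by (induction I rule: infinite_finite_induct) (auto intro!: Ck_on_const Ck_on_mult)

text \<open>For an affine inner map the derivative in direction \<open>v\<close> is the derivative
  of \<open>h\<close> in the fixed direction \<open>L v\<close>, composed with the same map. The
  induction therefore closes without a general chain rule for higher derivatives.\<close>

lemma Ck_on_compose_affine:
  assumes "Ck_on k h UNIV" "bounded_linear L"
  shows "Ck_on k (\<lambda>x. h (L x + d)) UNIV"
  using assms(1)
proof (induction k arbitrary: h)
  case 0
  have "continuous_on UNIV (\<lambda>x. L x + d)"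
    by (intro continuous_intros linear_continuous_on assms(2))
  then show ?case
    using 0 continuous_on_compose2[of UNIV h UNIV] by auto
next
  case (Suc k)
  note h = Ck_on_Suc_UNIV_D[OF Suc.prems]
  have L: "((\<lambda>x. L x + d) has_derivative L) (at x)" for x
    using bounded_linear_imp_has_derivative[OF assms(2)] by (auto intro!: derivative_eq_intros)
  show ?case
    by (rule Ck_on_Suc_UNIV_I[OF has_derivative_compose[OF L h(1)]]) (rule Suc.IH[OF h(2)])
qed

text \<open>The polynomial factor makes this family of functions closed under differentiation.\<close>

definition exp_bump :: "real \<Rightarrow> real poly \<Rightarrow> real \<Rightarrow> real" where
  "exp_bump c p t = (if t > 0 then poly p (1 / t) * exp (- (c / t)) else 0)"

text \<open>With \<open>s = 1 / t\<close> this is the flatness of \<open>exp_bump\<close> at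
  \<open>0\<close>: the exponential beats every power.\<close>

lemma poly_exp_tendsto_0:
  fixes c :: real
  assumes "c > 0"
  shows "((\<lambda>s. poly p s * exp (- (c * s))) \<longlongrightarrow> 0) at_top"
proof (induction p)
  case (pCons a p)
  have 2: "((\<lambda>s. s ^ n * exp (- (c * s))) \<longlongrightarrow> 0) at_top" for n
  proof -
    have "filterlim (\<lambda>s. c * s) at_top at_top"
      using assms by real_asymp
    from filterlim_compose[OF tendsto_power_div_exp_0 this]
    have "((\<lambda>s. 1 / c ^ n * ((c * s) ^ n / exp (c * s))) \<longlongrightarrow> 1 / c ^ n * 0) at_top"
      by (intro tendsto_mult tendsto_const)
    then show ?thesis
      using assms by (simp add: power_mult_distrib exp_minus field_simps)
  qed
  have 3: "((\<lambda>s. coeff p i * (s ^ Suc i * exp (- (c * s)))) \<longlongrightarrow> 0) at_top" for i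
    using tendsto_mult[OF tendsto_const 2, of "coeff p i" "Suc i"] by simp
  have 1: "((\<lambda>s. a * exp (- (c * s))) \<longlongrightarrow> 0) at_top"
    using tendsto_mult[OF tendsto_const 2, of a 0] by simp
  have "((\<lambda>s. a * exp (- (c * s)) + (\<Sum>i\<le>degree p. coeff p i * (s ^ Suc i * exp (- (c * s))))) \<longlongrightarrow>
      0 + (\<Sum>i\<le>degree p. 0)) at_top"
    by (intro tendsto_add tendsto_sum 1 3)
  then show ?case
    by (simp add: poly_altdef[of p] sum_distrib_left sum_distrib_right algebra_simps)
qed simp

text \<open>For \<open>t > 0\<close> both factors contribute \<open>1 / t^2\<close> by the chain
  rule, which is the polynomial \<open>[:0, 0, 1:]\<close> evaluated at \<open>1 / t\<close>. At
  \<open>0\<close> the difference quotient from the right is again such a product, with the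
  polynomial \<open>pCons 0 p\<close>, and tends to \<open>0\<close>.\<close>

lemma exp_bump_has_real_derivative:
  assumes "c > 0"
  shows "(exp_bump c p has_real_derivative
          exp_bump c ([:0, 0, 1:] * (smult c p - pderiv p)) t) (at t)"
proof -
  consider "t > 0" | "t < 0" | "t = 0" by linarith
  then show ?thesis
  proof cases
    case 1
    have "((\<lambda>t. poly p (1 / t) * exp (- (c / t))) has_real_derivative
          exp_bump c ([:0, 0, 1:] * (smult c p - pderiv p)) t) (at t)"
      using 1 by (auto intro!: derivative_eq_intros DERIV_chain2[OF poly_DERIV]
          simp: exp_bump_def field_simps power2_eq_square)
    then show ?thesis
      by (rule has_field_derivative_transform_within_open[where S="{0<..}"])
        (use 1 in \<open>auto simp: exp_bump_def\<close>)
  next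
    case 2
    have "((\<lambda>t. 0) has_real_derivative 0) (at t)" by simp
    then have "(exp_bump c p has_real_derivative 0) (at t)"
      by (rule has_field_derivative_transform_within_open[where S="{..<0}"])
        (use 2 in \<open>auto simp: exp_bump_def\<close>)
    then show ?thesis using 2 by (simp add: exp_bump_def)
  next
    case 3
    have "((\<lambda>s. poly (pCons 0 p) s * exp (- (c * s))) \<longlongrightarrow> 0) at_top"
      by (rule poly_exp_tendsto_0[OF assms])
    from filterlim_compose[OF this filterlim_inverse_at_top_right]
    have R: "((\<lambda>h. exp_bump c p h / h) \<longlongrightarrow> 0) (at_right 0)"
      by (rule Lim_transform_eventually)
        (auto simp: eventually_at_right_less exp_bump_def field_simps
          intro!: eventually_mono[OF eventually_at_right_less[of 0]])
    have L: "((\<lambda>h. exp_bump c p h / h) \<longlongrightarrow> 0) (at_left 0)"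
      by (rule Lim_transform_eventually[OF tendsto_const])
        (auto simp: exp_bump_def intro!: eventually_at_leftI[of "-1"])
    have "((\<lambda>h. exp_bump c p h / h) \<longlongrightarrow> 0) (at 0)"
      using L R filterlim_split_at by blast
    then show ?thesis
      using 3 by (simp add: DERIV_def exp_bump_def)
  qed
qed

lemma Ck_on_exp_bump:
  assumes "c > 0"
  shows "Ck_on k (exp_bump c p) UNIV"
proof (induction k arbitrary: p)
  case 0
  have "isCont (exp_bump c p) t" for t
    using exp_bump_has_real_derivative[OF assms] DERIV_isCont by blast
  then show ?case
    by (simp add: continuous_at_imp_continuous_on)
next
  case (Suc k)
  \<comment> \<open>The direction \<open>v\<close> is absorbed into the polynomial, so the
    directional derivative is again a member of the family and the induction hypothesis
    applies.\<close>
  have "(\<lambda>t. exp_bump c q t * v) = exp_bump c (smult v q)" for v q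
    by (auto simp: exp_bump_def)
  then show ?case
    using exp_bump_has_real_derivative[OF assms]
    by (intro Ck_on_Suc_UNIV_I[where f'="\<lambda>t v. exp_bump c ([:0, 0, 1:] * (smult c p - pderiv p)) t * v"])
      (auto simp: has_field_derivative_def Suc)
qed

lemma exp_bump_1_tendsto:
  "(\<lambda>n. exp_bump (1 / real (Suc n)) 1 t) \<longlonglongrightarrow> indicator {0<..} t"
proof (cases "t > 0")
  case True
  have "(\<lambda>n. exp (- ((1 / real (Suc n)) / t))) \<longlonglongrightarrow> 1"
    using True by real_asymp
  with True show ?thesis by (simp add: exp_bump_def)
qed (simp add: exp_bump_def)

lemma exp_bump_1_bounds:
  assumes "c > 0"
  shows "0 \<le> exp_bump c 1 t" "exp_bump c 1 t \<le> 1"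
  using assms by (auto simp: exp_bump_def)

text \<open>As \<open>c\<close> tends to \<open>0\<close>, these bumps increase to the indicator function of the open box.\<close>

definition box_bump :: "real \<Rightarrow> real^3 \<Rightarrow> real^3 \<Rightarrow> real^3 \<Rightarrow> real" where
  "box_bump c a b x = (\<Prod>i\<in>UNIV. exp_bump c 1 (x $ i - a $ i) * exp_bump c 1 (b $ i - x $ i))"

lemma box_bump_bounds:
  assumes "c > 0"
  shows "0 \<le> box_bump c a b x" "box_bump c a b x \<le> 1"
proof -
  note e = exp_bump_1_bounds[OF assms]
  show "0 \<le> box_bump c a b x"
    unfolding box_bump_def by (intro prod_nonneg mult_nonneg_nonneg e)
  show "box_bump c a b x \<le> 1"
    unfolding box_bump_def by (intro prod_le_1 conjI mult_nonneg_nonneg mult_le_one e)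
qed

lemma box_bump_eq_0: "x \<notin> box a b \<Longrightarrow> box_bump c a b x = 0"
  by (auto simp: box_bump_def mem_box_cart exp_bump_def intro!: prod_zero)

lemma box_bump_smooth_compact:
  assumes "c > 0" "cbox a b \<subseteq> S"
  shows "box_bump c a b \<in> smooth_compact S"
proof -
  have "Ck_on k (\<lambda>x. exp_bump c 1 (x $ i + (- a $ i))) UNIV"
    and "Ck_on k (\<lambda>x. exp_bump c 1 (- x $ i + b $ i)) UNIV" for k and i :: 3
    by (intro Ck_on_compose_affine Ck_on_exp_bump assms bounded_linear_minus bounded_linear_vec_nth)+
  then have "Ck_on k (box_bump c a b) UNIV" for k
    unfolding box_bump_def[abs_def] by (intro Ck_on_prod Ck_on_mult) simp_all
  moreover have "supp (box_bump c a b) \<subseteq> cbox a b"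
    unfolding supp_def
    by (intro closure_minimal closed_cbox) (use box_bump_eq_0 box_subset_cbox in blast)
  then have "compact (supp (box_bump c a b))" "supp (box_bump c a b) \<subseteq> S"
    using assms(2) by (auto simp: supp_def compact_eq_bounded_closed intro: bounded_subset[OF bounded_cbox])
  ultimately show ?thesis by (simp add: smooth_compact_def smooth_fun_on_def)
qed

lemma box_bump_tendsto:
  "(\<lambda>n. box_bump (1 / real (Suc n)) a b x) \<longlonglongrightarrow> indicator (box a b) x"
proof -
  have "(\<lambda>n. box_bump (1 / real (Suc n)) a b x) \<longlonglongrightarrow>
      (\<Prod>i\<in>UNIV. indicator {0<..} (x $ i - a $ i) * indicator {0<..} (b $ i - x $ i))"
    unfolding box_bump_def by (intro tendsto_prod tendsto_mult exp_bump_1_tendsto)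
  moreover have "(\<Prod>i\<in>UNIV. indicator {0<..} (x $ i - a $ i) * indicator {0<..} (b $ i - x $ i)) =
      (indicator (box a b) x :: real)"
    by (auto simp: indicator_def mem_box_cart of_bool_def)
  ultimately show ?thesis by simp
qed

subsection \<open>The fundamental lemma of the calculus of variations\<close>

text \<open>Open boxes form an intersection-stable generator of the Borel sets, so by a Dynkin
  argument the integral vanishes over every Borel set, and the density is zero. The argument runs on
  a Borel representative \<open>f'\<close>, since Lebesgue measure is the completion of
  \<open>lborel\<close>.\<close>

lemma AE_eq_0_if_box_integrals_eq_0:
  fixes f :: "'a::euclidean_space \<Rightarrow> real"
  assumes int: "integrable lebesgue f"
    and box: "\<And>a b. (LINT x|lebesgue. indicator (box a b) x * f x) = 0"
  shows "AE x in lebesgue. f x = 0"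
proof -
  obtain f' where f': "f' \<in> borel_measurable lborel" and AE: "AE x in lborel. f x = f' x"
    using completion_ex_borel_measurable_real[of f lborel] borel_measurable_integrable[OF int]
    by auto
  have AE_leb: "AE x in lebesgue. f x = f' x"
    using AE by (rule AE_completion)
  have f'_leb: "f' \<in> borel_measurable lebesgue"
    using f' by (rule measurable_completion)
  have "integrable lebesgue f'"
    using int AE_leb f'_leb integrable_cong_AE borel_measurable_integrable by metis
  then have int': "integrable lborel f'"
    using f' integrable_completion by metis
  have box': "(LINT x|lborel. indicator (box a b) x * f' x) = 0" for a b
  proof -
    have "(LINT x|lborel. indicator (box a b) x * f' x) =
        (LINT x|lebesgue. indicator (box a b) x * f' x)"
      using f' by (subst integral_completion) auto
    also have "\<dots> = (LINT x|lebesgue. indicator (box a b) x * f x)"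
      using AE_leb f'_leb borel_measurable_integrable[OF int]
      by (intro integral_cong_AE borel_measurable_times borel_measurable_indicator) auto
    finally show ?thesis using box by simp
  qed
  have ints: "integrable lborel (\<lambda>x. indicator A x * f' x)" if "A \<in> sets borel" for A
    using integrable_mult_indicator[OF _ int', of A] that by simp
  \<comment> \<open>Needed for complements in the Dynkin argument: the whole space is not a box, but
    it is exhausted by growing ones.\<close>
  have total: "(LINT x|lborel. f' x) = 0"
  proof -
    let ?B = "\<lambda>n::nat. box (- (real n *\<^sub>R One)) (real n *\<^sub>R One) :: 'a set"
    have "(\<lambda>n. LINT x|lborel. indicator (?B n) x * f' x) \<longlonglongrightarrow> (LINT x|lborel. f' x)"
    proof (rule integral_dominated_convergence[where w="\<lambda>x. \<bar>f' x\<bar>"])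
      show "AE x in lborel. (\<lambda>n. indicator (?B n) x * f' x) \<longlonglongrightarrow> f' x"
      proof (rule AE_I2, rule tendsto_eventually)
        fix x :: 'a
        obtain n0 where n0: "x \<in> ?B n0" using UN_box_eq_UNIV[where 'a='a] by auto
        have "x \<in> ?B n" if "n \<ge> n0" for n
        proof -
          have "box (- (real n0 *\<^sub>R One)) (real n0 *\<^sub>R One) \<subseteq> ?B n"
            using that by (intro subset_box_imp) auto
          with n0 show ?thesis by blast
        qed
        then show "\<forall>\<^sub>F n in sequentially. indicator (?B n) x * f' x = f' x"
          by (auto simp: eventually_sequentially intro!: exI[of _ n0])
      qed
    qed (use f' int' in \<open>auto simp: abs_mult indicator_def\<close>)
    then show ?thesis using box' by (simp add: LIMSEQ_const_iff)
  qed
  have "(LINT x|lborel. indicator A x * f' x) = 0" if "A \<in> sets borel" for A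
  proof -
    have "Int_stable (range (\<lambda>(a, b). box a b :: 'a set))"
      by (auto simp: Int_stable_def box_Int_box)
    moreover have "range (\<lambda>(a, b). box a b :: 'a set) \<subseteq> Pow UNIV" by simp
    moreover have "A \<in> sigma_sets UNIV (range (\<lambda>(a, b). box a b))"
      using that by (simp add: borel_eq_box)
    ultimately show ?thesis
    proof (induction rule: sigma_sets_induct_disjoint)
      case (basic A)
      then show ?case using box' by auto
    next
      case empty
      then show ?case by simp
    next
      case (compl A)
      then have A: "A \<in> sets borel" by (simp add: borel_eq_box)
      have "(LINT x|lborel. indicator (UNIV - A) x * f' x) =
          (LINT x|lborel. f' x - indicator A x * f' x)"
        by (intro Bochner_Integration.integral_cong) (auto simp: indicator_def)
      also have "\<dots> = 0"
        using total compl int' ints[OF A] by simp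
      finally show ?case .
    next
      case (union A)
      then have A: "A i \<in> sets borel" for i by (auto simp: borel_eq_box)
      then have U: "(\<Union>i. A i) \<in> sets borel" by auto
      have "set_lebesgue_integral lborel (\<Union>i. A i) f' = (\<Sum>i. set_lebesgue_integral lborel (A i) f')"
        using union(1) A ints[OF U]
        by (intro lebesgue_integral_countable_add) (auto simp: disjoint_family_on_def set_integrable_def)
      then show ?case using union by (simp add: set_lebesgue_integral_def)
    qed
  qed
  then have "AE x in lborel. f' x = 0"
    by (intro sigma_finite_measure.density_zero[OF sigma_finite_lborel int']) (simp add: set_lebesgue_integral_def)
  with AE have "AE x in lborel. f x = 0" by eventually_elim simp
  then show ?thesis by (rule AE_completion)
qed

lemma lebesgue_on_open:
  fixes S :: "'a::euclidean_space set"
  assumes "open S"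
  shows "S \<inter> space lebesgue \<in> sets lebesgue"
  using lmeasurable_open borel_open[OF assms] by auto

text \<open>The bumps supported in the closed box are admissible tests, are bounded by
  \<open>1\<close> and converge to the indicator of the open box. Since \<open>f\<close> is only
  locally integrable, the dominating function is \<open>f\<close> restricted to the closed
  box.\<close>

lemma fundamental_lemma_box:
  fixes f :: "real^3 \<Rightarrow> real"
  assumes \<Omega>: "open \<Omega>"
    and int: "\<And>K. compact K \<Longrightarrow> K \<subseteq> \<Omega> \<Longrightarrow> f absolutely_integrable_on K"
    and test: "\<And>\<phi>. \<phi> \<in> smooth_compact \<Omega> \<Longrightarrow> (LINT x|lebesgue_on \<Omega>. f x * \<phi> x) = 0"
    and A: "cbox a b \<subseteq> \<Omega>"
  shows "(LINT x|lebesgue. indicator (box a b) x * f x) = 0"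
proof -
  let ?\<phi> = "\<lambda>n. box_bump (1 / real (Suc n)) a b"
  let ?F = "\<lambda>x. indicator (cbox a b) x * f x"
  have F: "integrable lebesgue ?F"
    using int[OF compact_cbox A] by (simp add: set_integrable_def)
  have bump_meas: "?\<phi> n \<in> borel_measurable lebesgue" for n
  proof -
    have "Ck_on 0 (?\<phi> n) UNIV"
      using box_bump_smooth_compact[OF _ A, of "1 / real (Suc n)"]
      unfolding smooth_compact_def smooth_fun_on_def by simp
    then have "?\<phi> n \<in> borel_measurable borel"
      by (auto intro: borel_measurable_continuous_onI)
    then show ?thesis by (simp add: measurable_completion)
  qed
  have zero: "(LINT x|lebesgue. ?F x * ?\<phi> n x) = 0" for n
  proof -
    have "(LINT x|lebesgue. ?F x * ?\<phi> n x) = (LINT x|lebesgue. indicator \<Omega> x *\<^sub>R (f x * ?\<phi> n x))"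
      using A box_bump_eq_0[of _ a b] box_subset_cbox[of a b]
      by (intro Bochner_Integration.integral_cong) (auto simp: indicator_def)
    also have "\<dots> = (LINT x|lebesgue_on \<Omega>. f x * ?\<phi> n x)"
      by (rule integral_restrict_space[symmetric]) (rule lebesgue_on_open[OF \<Omega>])
    also have "\<dots> = 0" by (intro test box_bump_smooth_compact A) simp
    finally show ?thesis .
  qed
  have "(\<lambda>n. LINT x|lebesgue. ?F x * ?\<phi> n x) \<longlonglongrightarrow> (LINT x|lebesgue. ?F x * indicator (box a b) x)"
  proof (rule integral_dominated_convergence[where w="\<lambda>x. \<bar>?F x\<bar>"])
    show "(\<lambda>x. ?F x * indicator (box a b) x) \<in> borel_measurable lebesgue"
      by (intro borel_measurable_times[OF borel_measurable_integrable[OF F]] borel_measurable_indicator) auto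
    show "(\<lambda>x. ?F x * ?\<phi> n x) \<in> borel_measurable lebesgue" for n
      using bump_meas by (rule borel_measurable_times[OF borel_measurable_integrable[OF F]])
    show "integrable lebesgue (\<lambda>x. \<bar>?F x\<bar>)" using F by (rule integrable_abs)
    show "AE x in lebesgue. (\<lambda>n. ?F x * ?\<phi> n x) \<longlonglongrightarrow> ?F x * indicator (box a b) x"
      by (intro AE_I2 tendsto_mult tendsto_const box_bump_tendsto)
    show "AE x in lebesgue. norm (?F x * ?\<phi> n x) \<le> \<bar>?F x\<bar>" for n
      using box_bump_bounds[of "1 / real (Suc n)" a b]
      by (intro AE_I2) (simp add: abs_mult mult_left_le)
  qed
  then have "(LINT x|lebesgue. ?F x * indicator (box a b) x) = 0"
    using zero by (simp add: LIMSEQ_const_iff)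
  moreover have "?F x * indicator (box a b) x = indicator (box a b) x * f x" for x
    using box_subset_cbox[of a b] by (auto simp: indicator_def)
  ultimately show ?thesis by simp
qed

text \<open>Localization to countably many closed boxes with rational corners that cover
  \<open>\<Omega>\<close>. On each of them \<open>f\<close> is integrable, so its restriction to the
  interior has to be tested against all boxes only.\<close>

lemma fundamental_lemma:
  fixes f :: "real^3 \<Rightarrow> real"
  assumes \<Omega>: "open \<Omega>"
    and int: "\<And>K. compact K \<Longrightarrow> K \<subseteq> \<Omega> \<Longrightarrow> f absolutely_integrable_on K"
    and test: "\<And>\<phi>. \<phi> \<in> smooth_compact \<Omega> \<Longrightarrow> (LINT x|lebesgue_on \<Omega>. f x * \<phi> x) = 0"
  shows "AE x in lebesgue_on \<Omega>. f x = 0"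
proof -
  have cbox: "AE x in lebesgue. x \<in> cbox a b \<longrightarrow> f x = 0" if A: "cbox a b \<subseteq> \<Omega>" for a b
  proof -
    have "AE x in lebesgue. indicator (box a b) x * f x = 0"
    proof (rule AE_eq_0_if_box_integrals_eq_0)
      have "integrable lebesgue (\<lambda>x. indicator (cbox a b) x *\<^sub>R f x)"
        using int[OF compact_cbox A] by (simp add: set_integrable_def)
      then have "integrable lebesgue (\<lambda>x. indicator (box a b) x *\<^sub>R (indicator (cbox a b) x *\<^sub>R f x))"
        by (rule integrable_mult_indicator[rotated]) simp
      moreover have "(\<lambda>x. indicator (box a b) x *\<^sub>R (indicator (cbox a b) x *\<^sub>R f x)) = (\<lambda>x. indicator (box a b) x * f x)"
        using box_subset_cbox[of a b] by (auto simp: indicator_def fun_eq_iff)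
      ultimately show "integrable lebesgue (\<lambda>x. indicator (box a b) x * f x)" by (simp only:)
    next
      fix c d :: "real^3"
      \<comment> \<open>\<open>p\<close> and \<open>q\<close> are the corners of the intersection of
        the two boxes; the closed box they span stays inside \<open>cbox a b\<close>, hence inside
        \<open>\<Omega>\<close>.\<close>
      define p :: "real^3" where "p = (\<Sum>i\<in>Basis. max (c \<bullet> i) (a \<bullet> i) *\<^sub>R i)"
      define q :: "real^3" where "q = (\<Sum>i\<in>Basis. min (d \<bullet> i) (b \<bullet> i) *\<^sub>R i)"
      have "cbox p q \<subseteq> cbox a b"
        unfolding p_def q_def by (rule subset_box_imp) simp
      then have "(LINT x|lebesgue. indicator (box p q) x * f x) = 0"
        using fundamental_lemma_box[OF \<Omega> int test] A by blast
      moreover have "indicator (box p q) x * f x = indicator (box c d) x * (indicator (box a b) x * f x)" for x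
        using box_Int_box[of c d a b] by (auto simp: indicator_def p_def q_def set_eq_iff)
      ultimately show "(LINT x|lebesgue. indicator (box c d) x * (indicator (box a b) x * f x)) = 0"
        by simp
    qed
    \<comment> \<open>The cover consists of closed boxes, while the bumps see only open ones; the
      difference is a null set.\<close>
    moreover have "AE x in lebesgue. x \<notin> cbox a b - box a b"
      using negligible_frontier_interval[of a b] unfolding negligible_iff_null_sets by (rule AE_not_in)
    ultimately show ?thesis
      by eventually_elim (auto simp: indicator_def split: if_splits)
  qed
  define a' :: "(real^3 \<Rightarrow> real \<times> real) \<Rightarrow> real^3" where "a' = (\<lambda>f. \<Sum>i\<in>Basis. fst (f i) *\<^sub>R i)"
  define b' :: "(real^3 \<Rightarrow> real \<times> real) \<Rightarrow> real^3" where "b' = (\<lambda>f. \<Sum>i\<in>Basis. snd (f i) *\<^sub>R i)"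
  define I where "I = {f \<in> Basis \<rightarrow>\<^sub>E \<rat> \<times> \<rat>. cbox (a' f) (b' f) \<subseteq> \<Omega>}"
  have \<Omega>_eq: "\<Omega> = (\<Union>f\<in>I. cbox (a' f) (b' f))"
    unfolding I_def a'_def b'_def by (rule open_UNION_cbox[OF \<Omega>])
  have "countable I"
    unfolding I_def
    by (rule countable_subset[of _ "Basis \<rightarrow>\<^sub>E \<rat> \<times> \<rat>"])
      (auto intro!: countable_PiE countable_SIGMA countable_rat)
  then have "AE x in lebesgue. \<forall>i\<in>I. x \<in> cbox (a' i) (b' i) \<longrightarrow> f x = 0"
    by (subst AE_ball_countable) (auto simp: I_def intro!: cbox)
  then have "AE x in lebesgue. x \<in> \<Omega> \<longrightarrow> f x = 0"
    by eventually_elim (use \<Omega>_eq in blast)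
  then show ?thesis
    by (subst AE_restrict_space_iff[OF lebesgue_on_open[OF \<Omega>]])
qed

section \<open>Integrals of derivatives of compactly supported functions\<close>

lemma integrable_continuous_compact_support:
  fixes f :: "'a::euclidean_space \<Rightarrow> real"
  assumes "continuous_on UNIV f" "compact K" "\<And>x. x \<notin> K \<Longrightarrow> f x = 0"
  shows "integrable lborel f"
proof -
  have "integrable lborel (\<lambda>x. indicator K x *\<^sub>R f x)"
    using assms by (intro borel_integrable_compact) (auto intro: continuous_on_subset)
  moreover have "(\<lambda>x. indicator K x *\<^sub>R f x) = f"
    using assms(3) by (auto simp: indicator_def fun_eq_iff)
  ultimately show ?thesis by (simp only:)
qed

lemma has_derivative_outside_support:
  assumes der: "(f has_derivative f') (at x)"
    and "closed K" "\<And>x. x \<notin> K \<Longrightarrow> f x = 0" "x \<notin> K"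
  shows "f' = (\<lambda>_. 0)"
proof -
  have "((\<lambda>_. 0) has_derivative (\<lambda>_. 0)) (at x)" by simp
  then have "(f has_derivative (\<lambda>_. 0)) (at x)"
    by (rule has_derivative_transform_within_open[where s="- K"]) (use assms in auto)
  with der show ?thesis by (rule has_derivative_unique)
qed

text \<open>By translation invariance the difference quotients of \<open>f\<close> have integral \<open>0\<close>.\<close>

lemma integral_derivative_compact_support_eq_0:
  fixes f :: "'a::euclidean_space \<Rightarrow> real"
  assumes der: "\<And>x. (f has_derivative f' x) (at x)"
    and cont: "continuous_on UNIV (\<lambda>x. f' x v)"
    and K: "compact K" "\<And>x. x \<notin> K \<Longrightarrow> f x = 0"
  shows "(LINT x|lborel. f' x v) = 0"
proof -
  define s where "s n x = (f (x + (1 / real (Suc n)) *\<^sub>R v) - f x) * real (Suc n)" for n x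
  have f'_0: "f' x v = 0" if "x \<notin> K" for x
    using has_derivative_outside_support[OF der compact_imp_closed[OF K(1)] K(2) that] by simp
  have cf: "continuous_on UNIV f"
    using der has_derivative_continuous by (intro continuous_at_imp_continuous_on) blast
  have int: "integrable lborel f"
    by (rule integrable_continuous_compact_support[OF cf K])
  have shift: "integrable lborel (\<lambda>x. f (x + c))" "(LINT x|lborel. f (x + c)) = (LINT x|lborel. f x)" for c
  proof -
    have "integrable (distr lborel borel ((+) c)) f"
      using int by (simp add: lborel_distr_plus)
    then show "integrable lborel (\<lambda>x. f (x + c))"
      using integrable_distr[of "(+) c" lborel borel f] by (simp add: add.commute)
    have "(LINT x|lborel. f (x + c)) = integral\<^sup>L (distr lborel borel ((+) c)) f"
      using int by (subst integral_distr) (auto simp: add.commute)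
    then show "(LINT x|lborel. f (x + c)) = (LINT x|lborel. f x)"
      by (simp add: lborel_distr_plus)
  qed
  have s_int: "(LINT x|lborel. s n x) = 0" for n
    using shift[of "(1 / real (Suc n)) *\<^sub>R v"] int unfolding s_def by simp
  obtain B where B: "\<And>x. \<bar>f' x v\<bar> \<le> B"
  proof -
    have "compact ((\<lambda>x. f' x v) ` K)"
      using cont K(1) by (intro compact_continuous_image) (auto intro: continuous_on_subset)
    then obtain B where B: "\<forall>y\<in>(\<lambda>x. f' x v) ` K. norm y \<le> B"
      using compact_imp_bounded bounded_iff by metis
    show ?thesis
    proof (rule that)
      fix x show "\<bar>f' x v\<bar> \<le> max B 0"
        using B f'_0[of x] by (cases "x \<in> K") (auto simp: le_max_iff_disj)
    qed
  qed
  then have B0: "B \<ge> 0" using abs_ge_zero order_trans by blast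
  obtain r where r: "K \<subseteq> cball 0 r"
    using compact_imp_bounded[OF K(1)] bounded_subset_ballD[of K 0] ball_subset_cball by blast
  have line: "((\<lambda>t. f (x + t *\<^sub>R v)) has_real_derivative f' (x + t *\<^sub>R v) v) (at t)" for x t
  proof -
    have "((\<lambda>t. x + t *\<^sub>R v) has_derivative (\<lambda>t. t *\<^sub>R v)) (at t)"
      by (auto intro!: derivative_eq_intros)
    from has_derivative_compose[OF this der]
    have "((\<lambda>t. f (x + t *\<^sub>R v)) has_derivative (\<lambda>h. f' (x + t *\<^sub>R v) (h *\<^sub>R v))) (at t)" .
    moreover have "(\<lambda>h. f' (x + t *\<^sub>R v) (h *\<^sub>R v)) = (*) (f' (x + t *\<^sub>R v) v)"
      using linear_cmul[OF has_derivative_linear[OF der]] by (simp add: fun_eq_iff mult.commute)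
    ultimately show ?thesis unfolding has_field_derivative_def by (simp only:)
  qed
  \<comment> \<open>By the mean value theorem a difference quotient is a value of the directional
    derivative on the segment, so the bound is uniform in \<open>n\<close>.\<close>
  have bound: "\<bar>s n x\<bar> \<le> B" for n x
  proof -
    obtain z where "f (x + (1 / real (Suc n)) *\<^sub>R v) - f (x + 0 *\<^sub>R v) =
        (1 / real (Suc n) - 0) * f' (x + z *\<^sub>R v) v"
      using MVT2[of 0 "1 / real (Suc n)" "\<lambda>t. f (x + t *\<^sub>R v)" "\<lambda>t. f' (x + t *\<^sub>R v) v"] line by auto
    then have "s n x = f' (x + z *\<^sub>R v) v" by (simp add: s_def)
    then show ?thesis using B by simp
  qed
  \<comment> \<open>All shifts have norm at most \<open>norm v\<close>, so one ball contains the
    supports of all difference quotients; with \<open>bound\<close> this yields an integrable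
    majorant.\<close>
  have s_0: "s n x = 0" if "x \<notin> cball 0 (r + norm v)" for n x
  proof -
    have "norm ((1 / real (Suc n)) *\<^sub>R v) \<le> norm v"
      by (simp add: divide_le_eq mult_le_cancel_left1)
    moreover have "norm x > r + norm v" using that by simp
    ultimately have "norm (x + (1 / real (Suc n)) *\<^sub>R v) > r" "norm x > r"
      using norm_diff_ineq[of x "(1 / real (Suc n)) *\<^sub>R v"] norm_ge_zero[of v] by linarith+
    then have "x \<notin> K" "x + (1 / real (Suc n)) *\<^sub>R v \<notin> K" using r by auto
    then show ?thesis using K(2) by (simp add: s_def)
  qed
  have "(\<lambda>n. LINT x|lborel. s n x) \<longlonglongrightarrow> (LINT x|lborel. f' x v)"
  proof (rule integral_dominated_convergence[where w="\<lambda>x. B * indicator (cball 0 (r + norm v)) x"])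
    show "(\<lambda>x. f' x v) \<in> borel_measurable lborel"
      using cont by (simp add: borel_measurable_continuous_onI)
    have [measurable]: "f \<in> borel_measurable borel"
      using cf by (simp add: borel_measurable_continuous_onI)
    show "s n \<in> borel_measurable lborel" for n unfolding s_def by measurable
    show "integrable lborel (\<lambda>x. B * indicator (cball 0 (r + norm v)) x)"
      by (intro integrable_mult_right integrable_real_indicator)
        (use emeasure_bounded_finite[OF bounded_cball] in auto)
    show "AE x in lborel. (\<lambda>n. s n x) \<longlonglongrightarrow> f' x v"
    proof (rule AE_I2)
      fix x
      have "((\<lambda>h. (f (x + h *\<^sub>R v) - f x) / h) \<longlongrightarrow> f' x v) (at 0)"
        using line[of x 0] by (simp add: DERIV_def)
      moreover have "filterlim (\<lambda>n. 1 / real (Suc n)) (at 0) sequentially"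
        by (intro filterlim_atI) (use LIMSEQ_inverse_real_of_nat in \<open>auto simp: inverse_eq_divide\<close>)
      ultimately have "(\<lambda>n. (f (x + (1 / real (Suc n)) *\<^sub>R v) - f x) / (1 / real (Suc n))) \<longlonglongrightarrow> f' x v"
        by (rule filterlim_compose)
      then show "(\<lambda>n. s n x) \<longlonglongrightarrow> f' x v" by (simp add: s_def)
    qed
    show "AE x in lborel. norm (s n x) \<le> B * indicator (cball 0 (r + norm v)) x" for n
      using bound[of n] s_0[of _ n] B0 by (intro AE_I2) (auto simp: indicator_def)
  qed
  then show ?thesis using s_int by (simp add: LIMSEQ_const_iff)
qed

lemma integral_lebesgue_on_eq_lborel:
  fixes f :: "'a::euclidean_space \<Rightarrow> real"
  assumes "open S" "f \<in> borel_measurable borel" "\<And>x. x \<notin> S \<Longrightarrow> f x = 0"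
  shows "(LINT x|lebesgue_on S. f x) = (LINT x|lborel. f x)"
proof -
  have "(LINT x|lebesgue_on S. f x) = (LINT x|lebesgue. indicator S x *\<^sub>R f x)"
    by (rule integral_restrict_space) (rule lebesgue_on_open[OF assms(1)])
  also have "\<dots> = (LINT x|lebesgue. f x)"
    using assms(3) by (intro Bochner_Integration.integral_cong) (auto simp: indicator_def)
  also have "\<dots> = (LINT x|lborel. f x)"
    using assms(2) by (intro integral_completion) simp
  finally show ?thesis .
qed

lemma integral_lebesgue_on_derivative_eq_0:
  fixes f :: "'a::euclidean_space \<Rightarrow> real"
  assumes "open S"
    and der: "\<And>x. (f has_derivative f' x) (at x)"
    and cont: "continuous_on UNIV (\<lambda>x. f' x v)"
    and K: "compact K" "K \<subseteq> S" "\<And>x. x \<notin> K \<Longrightarrow> f x = 0"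
  shows "(LINT x|lebesgue_on S. f' x v) = 0"
proof -
  have "f' x v = 0" if "x \<notin> S" for x
    using has_derivative_outside_support[OF der compact_imp_closed[OF K(1)] K(3)] that K(2) by fastforce
  then have "(LINT x|lebesgue_on S. f' x v) = (LINT x|lborel. f' x v)"
    using assms(1) cont by (intro integral_lebesgue_on_eq_lborel borel_measurable_continuous_onI) auto
  then show ?thesis
    using integral_derivative_compact_support_eq_0[OF der cont K(1) K(3)] by simp
qed

lemma integrable_lebesgue_on_continuous:
  fixes f :: "'a::euclidean_space \<Rightarrow> 'b::euclidean_space"
  assumes "continuous_on UNIV f" "bounded S" "open S"
  shows "integrable (lebesgue_on S) f"
proof -
  obtain a where a: "S \<subseteq> cbox (-a) a" using bounded_subset_cbox_symmetric[OF assms(2)] by metis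
  have "f absolutely_integrable_on cbox (-a) a"
    by (intro absolutely_integrable_continuous continuous_on_subset[OF assms(1)]) simp
  then have "f absolutely_integrable_on S"
    using a assms(3) by (rule_tac set_integrable_subset) auto
  then show ?thesis
    using integrable_restrict_space[OF lebesgue_on_open[OF assms(3)], of f]
    by (simp add: set_integrable_def)
qed

subsection \<open>Weak derivatives\<close>

lemma integrable_lebesgue_on_mult_compact_support:
  fixes f \<phi> :: "real^3 \<Rightarrow> real"
  assumes "open S" "compact K" "K \<subseteq> S" "f absolutely_integrable_on K"
    and "continuous_on UNIV \<phi>" "\<And>x. x \<notin> K \<Longrightarrow> \<phi> x = 0"
  shows "integrable (lebesgue_on S) (\<lambda>x. f x * \<phi> x)"
proof -
  have "(\<lambda>x. \<phi> x * f x) absolutely_integrable_on K"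
  proof (rule absolutely_integrable_bounded_measurable_product[OF bilinear_times])
    show "K \<in> sets lebesgue" using assms(2) by (simp add: compact_imp_closed)
    show "\<phi> \<in> borel_measurable (lebesgue_on K)"
      using assms(5) by (intro measurable_restrict_space1 measurable_completion) 
        (simp add: borel_measurable_continuous_onI)
    show "bounded (\<phi> ` K)"
      using assms(2,5) by (intro compact_imp_bounded compact_continuous_image) (auto intro: continuous_on_subset)
  qed (fact assms(4))
  then have "integrable lebesgue (\<lambda>x. indicator K x *\<^sub>R (\<phi> x * f x))"
    by (simp add: set_integrable_def)
  moreover have "(\<lambda>x. indicator K x *\<^sub>R (\<phi> x * f x)) = (\<lambda>x. indicator S x *\<^sub>R (f x * \<phi> x))"
    using assms(3,6) by (auto simp: indicator_def fun_eq_iff)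
  ultimately show ?thesis
    by (subst integrable_restrict_space[OF lebesgue_on_open[OF assms(1)]]) (simp only:)
qed

lemma smooth_compactD:
  assumes "\<phi> \<in> smooth_compact \<Omega>"
  obtains K where "compact K" "K \<subseteq> \<Omega>" "\<And>x. x \<notin> K \<Longrightarrow> \<phi> x = 0" "Ck_on k \<phi> UNIV"
proof
  show "compact (supp \<phi>)" "supp \<phi> \<subseteq> \<Omega>" "Ck_on k \<phi> UNIV"
    using assms by (auto simp: smooth_compact_def smooth_fun_on_def)
  show "\<phi> x = 0" if "x \<notin> supp \<phi>" for x
    using that closure_subset[of "{x. \<phi> x \<noteq> 0}"] by (auto simp: supp_def)
qed

lemma absolutely_integrable_on_entry:
  fixes G :: "real^3 \<Rightarrow> real^3^3"
  assumes "G absolutely_integrable_on K"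
  shows "(\<lambda>x. G x $ i $ j) absolutely_integrable_on K"
proof -
  have "bounded_linear (\<lambda>A::real^3^3. A $ i $ j)"
    using bounded_linear_compose[OF bounded_linear_vec_nth bounded_linear_vec_nth] by blast
  from absolutely_integrable_linear[OF assms this] show ?thesis by (simp add: o_def)
qed

text \<open>The fundamental lemma applied to each entry of the difference. It makes the chosen
  \<open>weak_D\<close> computable: almost everywhere it equals any weak derivative that can be
  exhibited.\<close>

lemma has_weak_derivative_unique:
  assumes \<Omega>: "open \<Omega>" and G: "has_weak_derivative \<Omega> u G" and G': "has_weak_derivative \<Omega> u G'"
  shows "AE x in lebesgue_on \<Omega>. G x = G' x"
proof -
  have "AE x in lebesgue_on \<Omega>. G x $ i $ j - G' x $ i $ j = 0" for i j
  proof (rule fundamental_lemma[OF \<Omega>])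
    fix K assume K: "compact K" "K \<subseteq> \<Omega>"
    have "G absolutely_integrable_on K" "G' absolutely_integrable_on K"
      using G G' K by (auto simp: has_weak_derivative_def locally_integrable_def)
    then show "(\<lambda>x. G x $ i $ j - G' x $ i $ j) absolutely_integrable_on K"
      by (intro set_integral_diff(1) absolutely_integrable_on_entry)
  next
    fix \<phi> :: "real^3 \<Rightarrow> real" assume \<phi>: "\<phi> \<in> smooth_compact \<Omega>"
    then obtain K where K: "compact K" "K \<subseteq> \<Omega>" "\<And>x. x \<notin> K \<Longrightarrow> \<phi> x = 0" "Ck_on 0 \<phi> UNIV"
      using smooth_compactD by metis
    have int: "integrable (lebesgue_on \<Omega>) (\<lambda>x. F x $ i $ j * \<phi> x)" if "has_weak_derivative \<Omega> u F" for F
      using that K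
      by (intro integrable_lebesgue_on_mult_compact_support[OF \<Omega> K(1,2)] absolutely_integrable_on_entry)
        (auto simp: has_weak_derivative_def locally_integrable_def)
    have "(LINT x|lebesgue_on \<Omega>. G x $ i $ j * \<phi> x) = (LINT x|lebesgue_on \<Omega>. G' x $ i $ j * \<phi> x)"
      using G G' \<phi> unfolding has_weak_derivative_def by (metis (no_types, lifting) neg_equal_iff_equal)
    then show "(LINT x|lebesgue_on \<Omega>. (G x $ i $ j - G' x $ i $ j) * \<phi> x) = 0"
      using int[OF G] int[OF G'] by (simp add: left_diff_distrib)
  qed
  then have "AE x in lebesgue_on \<Omega>. \<forall>i j. G x $ i $ j - G' x $ i $ j = 0"
    by (simp add: AE_all_countable)
  then show ?thesis by eventually_elim (simp add: vec_eq_iff)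
qed

lemma weak_D_works: "has_weak_derivative \<Omega> u G \<Longrightarrow> has_weak_derivative \<Omega> u (weak_D \<Omega> u)"
  unfolding weak_D_def by (rule someI[of "has_weak_derivative \<Omega> u"])

lemma weak_D_AE_eq:
  assumes "open \<Omega>" "has_weak_derivative \<Omega> u G"
  shows "AE x in lebesgue_on \<Omega>. weak_D \<Omega> u x = G x"
  using has_weak_derivative_unique[OF assms(1) weak_D_works assms(2)] assms(2) by blast

lemma Ck_on_1_D:
  assumes "Ck_on 1 f UNIV"
  shows "(f has_derivative frechet_derivative f (at x)) (at x)"
    and "continuous_on UNIV (\<lambda>x. frechet_derivative f (at x) v)" and "continuous_on UNIV f"
  using Ck_on_Suc_UNIV_D[of 0 f] Ck_on_Suc_imp[of 0 f] assms by simp_all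

lemma continuous_imp_locally_integrable:
  "continuous_on UNIV f \<Longrightarrow> locally_integrable \<Omega> f"
  unfolding locally_integrable_def set_integrable_def
  by (auto intro!: integrable_completion[THEN iffD2] borel_integrable_compact borel_measurable_scaleR
      borel_measurable_indicator borel_measurable_continuous_onI borel_compact intro: continuous_on_subset)

text \<open>Only the product has to have compact support, so \<open>f\<close> may be arbitrary near
  the boundary. The integral of the derivative of the product is zero.\<close>

lemma integration_by_parts:
  fixes f \<phi> :: "real^3 \<Rightarrow> real"
  assumes S: "open S" and f: "\<And>x. (f has_derivative f' x) (at x)" "continuous_on UNIV (\<lambda>x. f' x v)"
    and \<phi>: "Ck_on 1 \<phi> UNIV" and K: "compact K" "K \<subseteq> S" "\<And>x. x \<notin> K \<Longrightarrow> \<phi> x = 0"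
  shows "(LINT x|lebesgue_on S. f x * frechet_derivative \<phi> (at x) v) =
    - (LINT x|lebesgue_on S. f' x v * \<phi> x)"
proof -
  note d\<phi> = Ck_on_1_D[OF \<phi>]
  have cf: "continuous_on UNIV f"
    using f(1) has_derivative_continuous by (intro continuous_at_imp_continuous_on) blast
  have \<phi>'_0: "frechet_derivative \<phi> (at x) v = 0" if "x \<notin> K" for x
    using has_derivative_outside_support[OF d\<phi>(1) compact_imp_closed[OF K(1)] K(3) that] by simp
  have aK: "h absolutely_integrable_on K" if "continuous_on UNIV h" for h :: "real^3 \<Rightarrow> real"
    using continuous_imp_locally_integrable[OF that, of UNIV] K(1) by (simp add: locally_integrable_def)
  have int: "integrable (lebesgue_on S) (\<lambda>x. f x * frechet_derivative \<phi> (at x) v)"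
    "integrable (lebesgue_on S) (\<lambda>x. f' x v * \<phi> x)"
    by (intro integrable_lebesgue_on_mult_compact_support[OF S K(1,2)] aK cf f(2) d\<phi>(2,3) \<phi>'_0 K(3); simp)+
  have "(LINT x|lebesgue_on S. f x * frechet_derivative \<phi> (at x) v + f' x v * \<phi> x) = 0"
    by (rule integral_lebesgue_on_derivative_eq_0[OF S has_derivative_mult[OF f(1) d\<phi>(1)]])
      (use K in \<open>auto intro!: continuous_intros cf f(2) d\<phi>(2,3)\<close>)
  then show ?thesis using int by simp
qed

lemma jacobian_nth: "jacobian u (at x) $ i $ j = frechet_derivative u (at x) (axis j 1) $ i"
  by (simp add: jacobian_def matrix_def)

lemma continuous_on_jacobian:
  fixes u :: "real^3 \<Rightarrow> real^3"
  assumes "Ck_on 1 u UNIV"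
  shows "continuous_on UNIV (\<lambda>x. jacobian u (at x))"
  unfolding jacobian_def matrix_def
  by (intro continuous_on_vec_lambda continuous_on_component Ck_on_1_D[OF assms])

lemma C1_has_weak_derivative:
  assumes \<Omega>: "open \<Omega>" and u: "Ck_on 1 u UNIV"
  shows "has_weak_derivative \<Omega> u (\<lambda>x. jacobian u (at x))"
  unfolding has_weak_derivative_def
proof (intro conjI ballI allI)
  note du = Ck_on_1_D[OF u]
  show "locally_integrable \<Omega> u" "locally_integrable \<Omega> (\<lambda>x. jacobian u (at x))"
    using du(3) continuous_on_jacobian[OF u] by (auto intro: continuous_imp_locally_integrable)
  fix \<phi> :: "real^3 \<Rightarrow> real" and i j :: 3
  assume "\<phi> \<in> smooth_compact \<Omega>"
  then obtain K where K: "compact K" "K \<subseteq> \<Omega>" "\<And>x. x \<notin> K \<Longrightarrow> \<phi> x = 0" "Ck_on 1 \<phi> UNIV"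
    using smooth_compactD by metis
  have "((\<lambda>x. u x $ i) has_derivative (\<lambda>h. frechet_derivative u (at x) h $ i)) (at x)" for x
    using bounded_linear.has_derivative[OF bounded_linear_vec_nth du(1)] .
  then show "(LINT x|lebesgue_on \<Omega>. u x $ i * frechet_derivative \<phi> (at x) (axis j 1)) =
      - (LINT x|lebesgue_on \<Omega>. jacobian u (at x) $ i $ j * \<phi> x)"
    unfolding jacobian_nth
    by (intro integration_by_parts[OF \<Omega> _ _ K(4) K(1-3)] continuous_on_component du(2))
qed

lemma has_weak_derivative_diff:
  assumes \<Omega>: "open \<Omega>" and u: "has_weak_derivative \<Omega> u G" and v: "has_weak_derivative \<Omega> v F"
  shows "has_weak_derivative \<Omega> (\<lambda>x. u x - v x) (\<lambda>x. G x - F x)"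
  unfolding has_weak_derivative_def
proof (intro conjI ballI allI)
  show "locally_integrable \<Omega> (\<lambda>x. u x - v x)" "locally_integrable \<Omega> (\<lambda>x. G x - F x)"
    using u v by (auto simp: has_weak_derivative_def locally_integrable_def)
  fix \<phi> :: "real^3 \<Rightarrow> real" and i j :: 3
  assume \<phi>: "\<phi> \<in> smooth_compact \<Omega>"
  then obtain K where K: "compact K" "K \<subseteq> \<Omega>" "\<And>x. x \<notin> K \<Longrightarrow> \<phi> x = 0" "Ck_on 1 \<phi> UNIV"
    using smooth_compactD by metis
  note d\<phi> = Ck_on_1_D[OF K(4)]
  have \<phi>'_0: "frechet_derivative \<phi> (at x) (axis j 1) = 0" if "x \<notin> K" for x
    using has_derivative_outside_support[OF d\<phi>(1) compact_imp_closed[OF K(1)] K(3) that] by simp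
  \<comment> \<open>Integrals of differences split only for integrable functions; local
    integrability is enough because \<open>\<phi>\<close> and its derivative vanish outside
    \<open>K\<close>.\<close>
  have int: "integrable (lebesgue_on \<Omega>) (\<lambda>x. w x $ i * frechet_derivative \<phi> (at x) (axis j 1))"
    "integrable (lebesgue_on \<Omega>) (\<lambda>x. W x $ i $ j * \<phi> x)" if w: "has_weak_derivative \<Omega> w W" for w W
  proof -
    have *: "w absolutely_integrable_on K" "W absolutely_integrable_on K"
      using w K(1,2) by (auto simp: has_weak_derivative_def locally_integrable_def)
    have "(\<lambda>x. w x $ i) absolutely_integrable_on K"
      using absolutely_integrable_linear[OF *(1) bounded_linear_vec_nth] by (simp add: o_def)
    then show "integrable (lebesgue_on \<Omega>) (\<lambda>x. w x $ i * frechet_derivative \<phi> (at x) (axis j 1))"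
      "integrable (lebesgue_on \<Omega>) (\<lambda>x. W x $ i $ j * \<phi> x)"
      using * by (auto intro!: integrable_lebesgue_on_mult_compact_support[OF \<Omega> K(1,2)]
        absolutely_integrable_on_entry d\<phi>(2,3) \<phi>'_0 K(3))
  qed
  have eq: "(LINT x|lebesgue_on \<Omega>. w x $ i * frechet_derivative \<phi> (at x) (axis j 1)) =
      - (LINT x|lebesgue_on \<Omega>. W x $ i $ j * \<phi> x)" if "has_weak_derivative \<Omega> w W" for w W
    using that \<phi> by (simp add: has_weak_derivative_def)
  show "(LINT x|lebesgue_on \<Omega>. (u x - v x) $ i * frechet_derivative \<phi> (at x) (axis j 1)) =
      - (LINT x|lebesgue_on \<Omega>. (G x - F x) $ i $ j * \<phi> x)"
    using int[OF u] int[OF v] eq[OF u] eq[OF v] by (simp add: left_diff_distrib)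
qed

section \<open>Products of square integrable functions\<close>

lemma integrable_mult_of_squares:
  fixes f h :: "'a \<Rightarrow> real"
  assumes "f \<in> borel_measurable M" "h \<in> borel_measurable M"
    and "integrable M (\<lambda>x. (f x)\<^sup>2)" "integrable M (\<lambda>x. (h x)\<^sup>2)"
  shows "integrable M (\<lambda>x. f x * h x)"
proof (rule Bochner_Integration.integrable_bound)
  show "integrable M (\<lambda>x. (f x)\<^sup>2 + (h x)\<^sup>2)" using assms by simp
  show "AE x in M. norm (f x * h x) \<le> norm ((f x)\<^sup>2 + (h x)\<^sup>2)"
  proof (rule AE_I2)
    fix x
    have "2 * (\<bar>f x\<bar> * \<bar>h x\<bar>) \<le> (f x)\<^sup>2 + (h x)\<^sup>2"
      using sum_squares_bound[of "\<bar>f x\<bar>" "\<bar>h x\<bar>"] by simp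
    moreover have "0 \<le> \<bar>f x\<bar> * \<bar>h x\<bar>" by simp
    ultimately have "\<bar>f x\<bar> * \<bar>h x\<bar> \<le> (f x)\<^sup>2 + (h x)\<^sup>2" by linarith
    then show "norm (f x * h x) \<le> norm ((f x)\<^sup>2 + (h x)\<^sup>2)"
      by (simp add: abs_mult)
  qed
qed (use assms in simp)

text \<open>Instead of the Cauchy-Schwarz inequality, the weighted form
  \<open>2 |f h| \<le> f^2 / s + s h^2\<close> is integrated. A small weight \<open>s\<close>
  controls the second term, and then large \<open>k\<close> controls the first.\<close>

lemma tendsto_integral_mult_L2:
  fixes f :: "nat \<Rightarrow> 'a \<Rightarrow> real"
  assumes f: "\<And>k. f k \<in> borel_measurable M" "\<And>k. integrable M (\<lambda>x. (f k x)\<^sup>2)"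
    and h: "h \<in> borel_measurable M" "integrable M (\<lambda>x. (h x)\<^sup>2)"
    and lim: "(\<lambda>k. LINT x|M. (f k x)\<^sup>2) \<longlonglongrightarrow> 0"
  shows "(\<lambda>k. LINT x|M. f k x * h x) \<longlonglongrightarrow> 0"
proof (rule LIMSEQ_I)
  fix r :: real assume r: "r > 0"
  define c where "c = (LINT x|M. (h x)\<^sup>2)"
  have c: "c \<ge> 0" by (simp add: c_def)
  \<comment> \<open>The summand \<open>1\<close> keeps the denominator positive when
    \<open>h\<close> vanishes and makes \<open>s * c < r\<close> strict.\<close>
  define s where "s = r / (c + 1)"
  have s: "s > 0" "s * c < r" using r c by (auto simp: s_def field_simps)
  have "r * s > 0" using r s by simp
  then obtain N where N: "\<And>k. k \<ge> N \<Longrightarrow> \<bar>LINT x|M. (f k x)\<^sup>2\<bar> < r * s"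
    using LIMSEQ_D[OF lim] by force
  show "\<exists>N. \<forall>k\<ge>N. norm ((LINT x|M. f k x * h x) - 0) < r"
  proof (intro exI allI impI)
    fix k assume "k \<ge> N"
    then have a: "(LINT x|M. (f k x)\<^sup>2) / s < r" using N[of k] s(1) by (simp add: field_simps)
    have fh: "integrable M (\<lambda>x. f k x * h x)"
      by (rule integrable_mult_of_squares) (use f h in auto)
    have "2 * (LINT x|M. \<bar>f k x * h x\<bar>) = (LINT x|M. 2 * \<bar>f k x * h x\<bar>)" by simp
    also have "\<dots> \<le> (LINT x|M. (f k x)\<^sup>2 / s + s * (h x)\<^sup>2)"
    proof (rule integral_mono)
      fix x
      have "0 \<le> (\<bar>f k x\<bar> - s * \<bar>h x\<bar>)\<^sup>2 / s" using s by simp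
      also have "\<dots> = (f k x)\<^sup>2 / s + s * (h x)\<^sup>2 - 2 * \<bar>f k x * h x\<bar>"
        using s by (simp add: power2_diff abs_mult field_simps power2_eq_square)
      finally show "2 * \<bar>f k x * h x\<bar> \<le> (f k x)\<^sup>2 / s + s * (h x)\<^sup>2" by simp
    qed (use f h fh in auto)
    also have "\<dots> = (LINT x|M. (f k x)\<^sup>2) / s + s * c" using f h by (simp add: c_def)
    also have "\<dots> < 2 * r" using a s by simp
    finally have "(LINT x|M. \<bar>f k x * h x\<bar>) < r" by simp
    then show "norm ((LINT x|M. f k x * h x) - 0) < r"
      using integral_abs_bound[of M "\<lambda>x. f k x * h x"] by (simp only: diff_zero real_norm_def)
  qed
qed

subsection \<open>Sobolev maps with zero boundary values\<close>

lemma integral_restrict_if: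
  fixes f :: "'a::euclidean_space \<Rightarrow> real"
  assumes "open \<Omega>" "open T" "\<Omega> \<subseteq> T"
  shows "(LINT x|lebesgue_on T. (if x \<in> \<Omega> then f x else 0)) = (LINT x|lebesgue_on \<Omega>. f x)"
    and "integrable (lebesgue_on T) (\<lambda>x. if x \<in> \<Omega> then f x else 0) \<longleftrightarrow> integrable (lebesgue_on \<Omega>) f"
proof -
  have eq: "(\<lambda>x. indicator T x *\<^sub>R (if x \<in> \<Omega> then f x else 0)) = (\<lambda>x. indicator \<Omega> x *\<^sub>R f x)"
    using assms(3) by (auto simp: indicator_def fun_eq_iff)
  show "(LINT x|lebesgue_on T. (if x \<in> \<Omega> then f x else 0)) = (LINT x|lebesgue_on \<Omega>. f x)"
    unfolding integral_restrict_space[OF lebesgue_on_open[OF assms(1)]]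
      integral_restrict_space[OF lebesgue_on_open[OF assms(2)]] eq ..
  show "integrable (lebesgue_on T) (\<lambda>x. if x \<in> \<Omega> then f x else 0) \<longleftrightarrow> integrable (lebesgue_on \<Omega>) f"
    unfolding integrable_restrict_space[OF lebesgue_on_open[OF assms(1)]]
      integrable_restrict_space[OF lebesgue_on_open[OF assms(2)]] eq ..
qed

text \<open>Completeness of Lebesgue measure. It carries measurability from an explicit function
  over to the chosen representative \<open>weak_D\<close> and to densities built from it.\<close>

lemma borel_measurable_lebesgue_on_AE:
  fixes f g :: "'a::euclidean_space \<Rightarrow> 'b::euclidean_space"
  assumes S: "open S" and f: "f \<in> borel_measurable (lebesgue_on S)" and AE: "AE x in lebesgue_on S. f x = g x"
  shows "g \<in> borel_measurable (lebesgue_on S)"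
proof -
  have "(\<lambda>x. indicator S x *\<^sub>R g x) \<in> borel_measurable lebesgue"
  proof (rule borel_measurable_AE)
    show "(\<lambda>x. indicator S x *\<^sub>R f x) \<in> borel_measurable lebesgue"
      using f by (subst (asm) borel_measurable_restrict_space_iff[OF lebesgue_on_open[OF S]])
    have "AE x in lebesgue. x \<in> S \<longrightarrow> f x = g x"
      using AE by (subst (asm) AE_restrict_space_iff[OF lebesgue_on_open[OF S]])
    then show "AE x in lebesgue. indicator S x *\<^sub>R f x = indicator S x *\<^sub>R g x"
      by eventually_elim (auto simp: indicator_def)
  qed
  then show ?thesis by (subst borel_measurable_restrict_space_iff[OF lebesgue_on_open[OF S]])
qed

lemma borel_measurable_lebesgue_on_continuous:
  fixes f :: "'a::euclidean_space \<Rightarrow> 'b::euclidean_space"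
  assumes "continuous_on UNIV f"
  shows "f \<in> borel_measurable (lebesgue_on S)"
  using assms by (intro measurable_restrict_space1 measurable_completion) (simp add: borel_measurable_continuous_onI)

lemma square_integrable_continuous:
  fixes f :: "real^3 \<Rightarrow> 'b::euclidean_space"
  assumes "open S" "bounded S" "continuous_on UNIV f"
  shows "square_integrable S f"
  unfolding square_integrable_def
  using assms by (auto intro!: borel_measurable_lebesgue_on_continuous integrable_lebesgue_on_continuous continuous_intros)

lemma power2_norm_diff_le: "(norm (a - b))\<^sup>2 \<le> 2 * (norm a)\<^sup>2 + 2 * (norm b)\<^sup>2"
  for a b :: "'a::real_normed_vector"
proof -
  have "(norm (a - b))\<^sup>2 \<le> (norm a + norm b)\<^sup>2"
    by (intro power_mono norm_triangle_ineq4) simp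
  then show ?thesis using sum_squares_bound[of "norm a" "norm b"] by (simp add: power2_sum)
qed

lemma square_integrable_diff:
  assumes "square_integrable S f" "square_integrable S h"
  shows "square_integrable S (\<lambda>x. f x - h x)"
  unfolding square_integrable_def
proof
  show m: "(\<lambda>x. f x - h x) \<in> borel_measurable (lebesgue_on S)"
    using assms by (auto simp: square_integrable_def)
  show "integrable (lebesgue_on S) (\<lambda>x. (norm (f x - h x))\<^sup>2)"
  proof (rule Bochner_Integration.integrable_bound)
    show "integrable (lebesgue_on S) (\<lambda>x. 2 * (norm (f x))\<^sup>2 + 2 * (norm (h x))\<^sup>2)"
      using assms by (auto simp: square_integrable_def)
    show "AE x in lebesgue_on S. norm ((norm (f x - h x))\<^sup>2) \<le> norm (2 * (norm (f x))\<^sup>2 + 2 * (norm (h x))\<^sup>2)"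
      by (intro AE_I2) (simp add: power2_norm_diff_le)
  qed (use m in measurable)
qed

lemma square_integrable_component:
  fixes f :: "real^3 \<Rightarrow> 'b::euclidean_space" and L :: "'b \<Rightarrow> real"
  assumes f: "square_integrable S f" and L: "bounded_linear L" "\<And>y. \<bar>L y\<bar> \<le> norm y"
  shows "(\<lambda>x. L (f x)) \<in> borel_measurable (lebesgue_on S)"
    and "integrable (lebesgue_on S) (\<lambda>x. (L (f x))\<^sup>2)"
    and "(LINT x|lebesgue_on S. (L (f x))\<^sup>2) \<le> (LINT x|lebesgue_on S. (norm (f x))\<^sup>2)"
proof -
  have [measurable]: "L \<in> borel_measurable borel"
    using linear_continuous_on[OF L(1)] by (rule borel_measurable_continuous_onI)
  have le: "(L y)\<^sup>2 \<le> (norm y)\<^sup>2" for y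
    using L(2)[of y] by (simp add: abs_le_square_iff[symmetric])
  show m: "(\<lambda>x. L (f x)) \<in> borel_measurable (lebesgue_on S)"
    using f by (auto simp: square_integrable_def intro: measurable_compose)
  show i: "integrable (lebesgue_on S) (\<lambda>x. (L (f x))\<^sup>2)"
    by (rule Bochner_Integration.integrable_bound[where f="\<lambda>x. (norm (f x))\<^sup>2"])
      (use f m le in \<open>auto simp: square_integrable_def\<close>)
  show "(LINT x|lebesgue_on S. (L (f x))\<^sup>2) \<le> (LINT x|lebesgue_on S. (norm (f x))\<^sup>2)"
    using f i le by (intro integral_mono) (auto simp: square_integrable_def)
qed

lemma bounded_linear_entry: "bounded_linear (\<lambda>A::real^3^3. A $ i $ j)"
  using bounded_linear_compose[OF bounded_linear_vec_nth bounded_linear_vec_nth] by blast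

lemma abs_entry_le_norm: "\<bar>A $ i $ j\<bar> \<le> norm (A::real^3^3)"
  using component_le_norm_cart[of "A $ i" j] Finite_Cartesian_Product.norm_nth_le[of A i] by linarith

lemmas square_integrable_nth =
  square_integrable_component[OF _ bounded_linear_vec_nth component_le_norm_cart]
lemmas square_integrable_entry =
  square_integrable_component[OF _ bounded_linear_entry abs_entry_le_norm]

lemma square_integrable_imp_integrable:
  fixes f :: "real^3 \<Rightarrow> 'b::euclidean_space"
  assumes "open S" "bounded S" "square_integrable S f"
  shows "integrable (lebesgue_on S) f"
proof (rule Bochner_Integration.integrable_bound)
  show "integrable (lebesgue_on S) (\<lambda>x. 1 + (norm (f x))\<^sup>2)"
    using assms integrable_lebesgue_on_continuous[of "\<lambda>_. 1::real" S]
    by (auto simp: square_integrable_def)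
  show "AE x in lebesgue_on S. norm (f x) \<le> norm (1 + (norm (f x))\<^sup>2)"
  proof (rule AE_I2)
    fix x
    have "2 * norm (f x) \<le> 1 + (norm (f x))\<^sup>2"
      using sum_squares_bound[of 1 "norm (f x)"] by simp
    then have "norm (f x) \<le> 1 + (norm (f x))\<^sup>2" using norm_ge_zero[of "f x"] by linarith
    then show "norm (f x) \<le> norm (1 + (norm (f x))\<^sup>2)" by simp
  qed
qed (use assms in \<open>auto simp: square_integrable_def\<close>)

text \<open>Unpacks \<open>W12_norm\<close>: the weak derivative of the difference is computed
  almost everywhere, and the square of the norm is a sum of two nonnegative terms, each of which
  then tends to \<open>0\<close>.\<close>

lemma W12_0_approx:
  assumes \<Omega>: "open \<Omega>" "bounded \<Omega>" and u: "u \<in> W12_0 \<Omega>"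
  obtains \<phi> where "\<And>k::nat. \<phi> k \<in> smooth_compact \<Omega>"
    and "\<And>k. square_integrable \<Omega> (\<lambda>x. \<phi> k x - u x)"
    and "\<And>k. square_integrable \<Omega> (\<lambda>x. jacobian (\<phi> k) (at x) - weak_D \<Omega> u x)"
    and "(\<lambda>k. LINT x|lebesgue_on \<Omega>. (norm (\<phi> k x - u x))\<^sup>2) \<longlonglongrightarrow> 0"
    and "(\<lambda>k. LINT x|lebesgue_on \<Omega>. (norm (jacobian (\<phi> k) (at x) - weak_D \<Omega> u x))\<^sup>2) \<longlonglongrightarrow> 0"
proof -
  obtain \<phi> where \<phi>: "\<And>k::nat. \<phi> k \<in> smooth_compact \<Omega>"
      and lim: "(\<lambda>k. W12_norm \<Omega> (\<lambda>x. \<phi> k x - u x)) \<longlonglongrightarrow> 0"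
    using u by (auto simp: W12_0_def)
  have u1: "square_integrable \<Omega> u" "square_integrable \<Omega> (weak_D \<Omega> u)"
      "has_weak_derivative \<Omega> u (weak_D \<Omega> u)"
    using u weak_D_works by (auto simp: W12_0_def W12_def)
  have C1: "Ck_on 1 (\<phi> k) UNIV" for k
    using \<phi>[of k] by (simp add: smooth_compact_def smooth_fun_on_def)
  have s1: "square_integrable \<Omega> (\<lambda>x. \<phi> k x - u x)" for k
    by (intro square_integrable_diff u1 square_integrable_continuous \<Omega> Ck_on_1_D[OF C1])
  have s2: "square_integrable \<Omega> (\<lambda>x. jacobian (\<phi> k) (at x) - weak_D \<Omega> u x)" for k
    by (intro square_integrable_diff u1 square_integrable_continuous \<Omega> continuous_on_jacobian C1)
  let ?A = "\<lambda>k. LINT x|lebesgue_on \<Omega>. (norm (\<phi> k x - u x))\<^sup>2"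
  let ?B = "\<lambda>k. LINT x|lebesgue_on \<Omega>. (norm (jacobian (\<phi> k) (at x) - weak_D \<Omega> u x))\<^sup>2"
  have AB: "(\<lambda>k. ?A k + ?B k) \<longlonglongrightarrow> 0"
  proof -
    have "(W12_norm \<Omega> (\<lambda>x. \<phi> k x - u x))\<^sup>2 = ?A k + ?B k" for k
    proof -
      have AE: "AE x in lebesgue_on \<Omega>. weak_D \<Omega> (\<lambda>x. \<phi> k x - u x) x = jacobian (\<phi> k) (at x) - weak_D \<Omega> u x"
        by (intro weak_D_AE_eq has_weak_derivative_diff C1_has_weak_derivative \<Omega> C1 u1)
      have m: "(\<lambda>x. jacobian (\<phi> k) (at x) - weak_D \<Omega> u x) \<in> borel_measurable (lebesgue_on \<Omega>)"
        using s2 by (simp add: square_integrable_def)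
      then have m': "weak_D \<Omega> (\<lambda>x. \<phi> k x - u x) \<in> borel_measurable (lebesgue_on \<Omega>)"
        by (rule borel_measurable_lebesgue_on_AE[OF \<Omega>(1)]) (use AE in eventually_elim, simp)
      have "(LINT x|lebesgue_on \<Omega>. (norm (weak_D \<Omega> (\<lambda>x. \<phi> k x - u x) x))\<^sup>2) = ?B k"
      proof (rule integral_cong_AE)
        show "AE x in lebesgue_on \<Omega>. (norm (weak_D \<Omega> (\<lambda>x. \<phi> k x - u x) x))\<^sup>2 =
            (norm (jacobian (\<phi> k) (at x) - weak_D \<Omega> u x))\<^sup>2"
          using AE by eventually_elim simp
      qed (use m m' in measurable)
      moreover have "?A k \<ge> 0" "?B k \<ge> 0" by simp_all
      ultimately show ?thesis by (simp add: W12_norm_def)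
    qed
    with tendsto_power[OF lim, of 2] show ?thesis by simp
  qed
  have "?A \<longlonglongrightarrow> 0"
    by (rule tendsto_sandwich[OF _ _ tendsto_const AB]) auto
  moreover have "?B \<longlonglongrightarrow> 0"
    by (rule tendsto_sandwich[OF _ _ tendsto_const AB]) auto
  ultimately show ?thesis using that \<phi> s1 s2 by blast
qed

lemma C1_nth:
  fixes f :: "real^3 \<Rightarrow> real^3"
  assumes "Ck_on 1 f UNIV"
  shows "((\<lambda>x. f x $ i) has_derivative (\<lambda>h. frechet_derivative f (at x) h $ i)) (at x)"
    and "frechet_derivative (\<lambda>x. f x $ i) (at x) (axis j 1) = jacobian f (at x) $ i $ j"
    and "Ck_on 1 (\<lambda>x. f x $ i) UNIV"
proof -
  note df = Ck_on_1_D[OF assms]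
  show d: "((\<lambda>x. f x $ i) has_derivative (\<lambda>h. frechet_derivative f (at x) h $ i)) (at x)" for x
    using bounded_linear.has_derivative[OF bounded_linear_vec_nth df(1)] .
  show "frechet_derivative (\<lambda>x. f x $ i) (at x) (axis j 1) = jacobian f (at x) $ i $ j"
    using frechet_derivative_at[OF d[of x]] by (simp add: jacobian_nth fun_eq_iff)
  show "Ck_on 1 (\<lambda>x. f x $ i) UNIV"
    unfolding One_nat_def
    by (rule Ck_on_Suc_UNIV_I[OF d]) (simp add: continuous_on_component df(2))
qed

text \<open>No boundary term appears because \<open>u\<close> itself is a limit of compactly
  supported maps, so \<open>\<psi>\<close> may be any \<open>C^1\<close> function on the whole
  space. The two main uses are \<open>\<psi> = 1\<close>, which gives \<open>Du\<close> mean zero,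
  and test functions of a larger domain.\<close>

lemma W12_0_integration_by_parts:
  assumes \<Omega>: "open \<Omega>" "bounded \<Omega>" and u: "u \<in> W12_0 \<Omega>" and \<psi>: "Ck_on 1 \<psi> UNIV"
  shows "(LINT x|lebesgue_on \<Omega>. u x $ i * frechet_derivative \<psi> (at x) (axis j 1)) =
    - (LINT x|lebesgue_on \<Omega>. weak_D \<Omega> u x $ i $ j * \<psi> x)"
proof -
  note d\<psi> = Ck_on_1_D[OF \<psi>]
  obtain \<phi> where \<phi>: "\<And>k::nat. \<phi> k \<in> smooth_compact \<Omega>"
    and s: "\<And>k. square_integrable \<Omega> (\<lambda>x. \<phi> k x - u x)"
      "\<And>k. square_integrable \<Omega> (\<lambda>x. jacobian (\<phi> k) (at x) - weak_D \<Omega> u x)"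
    and lim: "(\<lambda>k. LINT x|lebesgue_on \<Omega>. (norm (\<phi> k x - u x))\<^sup>2) \<longlonglongrightarrow> 0"
      "(\<lambda>k. LINT x|lebesgue_on \<Omega>. (norm (jacobian (\<phi> k) (at x) - weak_D \<Omega> u x))\<^sup>2) \<longlonglongrightarrow> 0"
    using W12_0_approx[OF \<Omega> u] by blast
  have us: "square_integrable \<Omega> u" "square_integrable \<Omega> (weak_D \<Omega> u)"
    using u by (auto simp: W12_0_def W12_def)
  let ?h = "\<lambda>x. frechet_derivative \<psi> (at x) (axis j 1)"
  have hs: "h \<in> borel_measurable (lebesgue_on \<Omega>)" "integrable (lebesgue_on \<Omega>) (\<lambda>x. (h x)\<^sup>2)"
    if "continuous_on UNIV h" for h :: "real^3 \<Rightarrow> real"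
    using square_integrable_continuous[OF \<Omega> that] by (simp_all add: square_integrable_def)
  note h = hs[OF d\<psi>(2)] and p = hs[OF d\<psi>(3)]
  have l1: "(\<lambda>k. LINT x|lebesgue_on \<Omega>. (\<phi> k x - u x) $ i * ?h x) \<longlonglongrightarrow> 0"
    by (intro tendsto_integral_mult_L2 h square_integrable_nth(1,2)[OF s(1)])
      (rule tendsto_sandwich[OF _ _ tendsto_const lim(1)], use square_integrable_nth(3)[OF s(1)] in auto)
  have l2: "(\<lambda>k. LINT x|lebesgue_on \<Omega>. (jacobian (\<phi> k) (at x) - weak_D \<Omega> u x) $ i $ j * \<psi> x) \<longlonglongrightarrow> 0"
    by (intro tendsto_integral_mult_L2 p square_integrable_entry(1,2)[OF s(2)])
      (rule tendsto_sandwich[OF _ _ tendsto_const lim(2)], use square_integrable_entry(3)[OF s(2)] in auto)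
  \<comment> \<open>Integration by parts for \<open>\<phi> k\<close> cancels its contribution, so
    the sum of the two errors does not depend on \<open>k\<close>. As it tends to \<open>0\<close>,
    it is \<open>0\<close>.\<close>
  have eq: "(LINT x|lebesgue_on \<Omega>. (\<phi> k x - u x) $ i * ?h x) +
      (LINT x|lebesgue_on \<Omega>. (jacobian (\<phi> k) (at x) - weak_D \<Omega> u x) $ i $ j * \<psi> x) =
      - ((LINT x|lebesgue_on \<Omega>. u x $ i * ?h x) + (LINT x|lebesgue_on \<Omega>. weak_D \<Omega> u x $ i $ j * \<psi> x))" for k
  proof -
    obtain K where K: "compact K" "K \<subseteq> \<Omega>" "\<And>x. x \<notin> K \<Longrightarrow> \<phi> k x = 0" "Ck_on 1 (\<phi> k) UNIV"
      using smooth_compactD[OF \<phi>] by metis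
    have "(LINT x|lebesgue_on \<Omega>. \<psi> x * frechet_derivative (\<lambda>x. \<phi> k x $ i) (at x) (axis j 1)) =
      - (LINT x|lebesgue_on \<Omega>. ?h x * \<phi> k x $ i)"
      using K by (intro integration_by_parts[OF \<Omega>(1) d\<psi>(1,2) C1_nth(3)]) auto
    then have 1: "(LINT x|lebesgue_on \<Omega>. jacobian (\<phi> k) (at x) $ i $ j * \<psi> x) =
      - (LINT x|lebesgue_on \<Omega>. \<phi> k x $ i * ?h x)"
      using C1_nth(2)[OF K(4)] by (simp add: mult.commute)
    have \<phi>s: "square_integrable \<Omega> (\<phi> k)" "square_integrable \<Omega> (\<lambda>x. jacobian (\<phi> k) (at x))"
      by (intro square_integrable_continuous \<Omega> Ck_on_1_D[OF K(4)] continuous_on_jacobian K(4))+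
    have "integrable (lebesgue_on \<Omega>) (\<lambda>x. w x $ i * ?h x)" if "square_integrable \<Omega> w" for w
      by (intro integrable_mult_of_squares square_integrable_nth[OF that] h)
    note i1 = this[OF us(1)] this[OF \<phi>s(1)]
    have "integrable (lebesgue_on \<Omega>) (\<lambda>x. w x $ i $ j * \<psi> x)" if "square_integrable \<Omega> w" for w
      by (intro integrable_mult_of_squares square_integrable_entry[OF that] p)
    note i2 = this[OF us(2)] this[OF \<phi>s(2)]
    show ?thesis using i1 i2 1 by (simp add: left_diff_distrib)
  qed
  have "(\<lambda>k::nat. - ((LINT x|lebesgue_on \<Omega>. u x $ i * ?h x) + (LINT x|lebesgue_on \<Omega>. weak_D \<Omega> u x $ i $ j * \<psi> x))) \<longlonglongrightarrow> 0 + 0"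
    using tendsto_add[OF l1 l2] unfolding eq .
  then show ?thesis by (simp add: LIMSEQ_const_iff)
qed

lemma W12_0_integral_weak_D:
  assumes \<Omega>: "open \<Omega>" "bounded \<Omega>" and u: "u \<in> W12_0 \<Omega>"
  shows "(LINT x|lebesgue_on \<Omega>. weak_D \<Omega> u x $ i $ j) = 0"
  using W12_0_integration_by_parts[OF \<Omega> u Ck_on_const[of 1 "1::real"], of i j] by simp

text \<open>The integral of \<open>\<partial>\<^sub>1 (x\<^sub>1 f\<^sup>2) = f\<^sup>2 + 2 x\<^sub>1 f \<partial>\<^sub>1f\<close> vanishes.\<close>

lemma poincare_inequality:
  fixes f :: "real^3 \<Rightarrow> real"
  assumes \<Omega>: "open \<Omega>" "\<Omega> \<subseteq> cball 0 L" and f: "Ck_on 1 f UNIV"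
    and K: "compact K" "K \<subseteq> \<Omega>" "\<And>x. x \<notin> K \<Longrightarrow> f x = 0"
  shows "(LINT x|lebesgue_on \<Omega>. (f x)\<^sup>2) \<le>
    4 * L\<^sup>2 * (LINT x|lebesgue_on \<Omega>. (frechet_derivative f (at x) (axis 1 1))\<^sup>2)"
proof -
  note df = Ck_on_1_D[OF f]
  let ?d = "\<lambda>x. frechet_derivative f (at x) (axis 1 1)"
  have b: "bounded \<Omega>" using bounded_subset[OF bounded_cball \<Omega>(2)] .
  have d: "((\<lambda>x. x $ 1 * (f x)\<^sup>2) has_derivative
      (\<lambda>h. x $ 1 * (2 * f x * frechet_derivative f (at x) h) + h $ 1 * (f x)\<^sup>2)) (at x)" for x
    using df(1)[of x]
    by (auto intro!: derivative_eq_intros bounded_linear.has_derivative[OF bounded_linear_vec_nth, of "\<lambda>x. x"])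
  have c: "continuous_on UNIV (\<lambda>x. x $ 1 * (2 * f x * ?d x))" "continuous_on UNIV (\<lambda>x. (f x)\<^sup>2)"
      "continuous_on UNIV (\<lambda>x. (?d x)\<^sup>2)"
    by (intro continuous_intros df)+
  note int = c[THEN integrable_lebesgue_on_continuous[OF _ b \<Omega>(1)]]
  have "(LINT x|lebesgue_on \<Omega>. x $ 1 * (2 * f x * ?d x) + (axis 1 1 :: real^3) $ 1 * (f x)\<^sup>2) = 0"
    by (rule integral_lebesgue_on_derivative_eq_0[OF \<Omega>(1) d, where K=K])
      (use K c in \<open>auto intro!: continuous_intros\<close>)
  then have "(LINT x|lebesgue_on \<Omega>. x $ 1 * (2 * f x * ?d x)) + (LINT x|lebesgue_on \<Omega>. (f x)\<^sup>2) = 0"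
    using int by simp
  then have "(LINT x|lebesgue_on \<Omega>. (f x)\<^sup>2) = (LINT x|lebesgue_on \<Omega>. - (x $ 1 * (2 * f x * ?d x)))"
    by simp
  \<comment> \<open>The mixed term is split so that exactly half of the integral of
    \<open>f^2\<close> can be absorbed on the left; this turns \<open>2 * L\<^sup>2\<close> into the
    constant \<open>4 * L\<^sup>2\<close>.\<close>
  also have "\<dots> \<le> (LINT x|lebesgue_on \<Omega>. (f x)\<^sup>2 / 2 + 2 * L\<^sup>2 * (?d x)\<^sup>2)"
  proof (rule integral_mono)
    fix x assume "x \<in> space (lebesgue_on \<Omega>)"
    then have "norm x \<le> L" using \<Omega>(2) by (auto simp: space_restrict_space)
    then have "\<bar>x $ 1\<bar> \<le> L" using component_le_norm_cart[of x 1] by linarith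
    then have "(x $ 1)\<^sup>2 \<le> L\<^sup>2" using abs_le_square_iff[of "x $ 1" L] by simp
    then have "2 * (x $ 1)\<^sup>2 * (?d x)\<^sup>2 \<le> 2 * L\<^sup>2 * (?d x)\<^sup>2"
      by (intro mult_right_mono) auto
    moreover have "0 \<le> (f x + 2 * x $ 1 * ?d x)\<^sup>2 / 2" by simp
    then have "- (x $ 1 * (2 * f x * ?d x)) \<le> (f x)\<^sup>2 / 2 + 2 * (x $ 1)\<^sup>2 * (?d x)\<^sup>2"
      by (simp add: power2_sum power_mult_distrib field_simps)
    ultimately show "- (x $ 1 * (2 * f x * ?d x)) \<le> (f x)\<^sup>2 / 2 + 2 * L\<^sup>2 * (?d x)\<^sup>2" by linarith
  qed (use int in auto)
  also have "\<dots> = (LINT x|lebesgue_on \<Omega>. (f x)\<^sup>2) / 2 + 2 * L\<^sup>2 * (LINT x|lebesgue_on \<Omega>. (?d x)\<^sup>2)"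
    using int by simp
  finally show ?thesis by simp
qed

text \<open>The Poincare inequality is available for the approximating maps only. Since
  \<open>Du = 0\<close>, their gradients coincide almost everywhere with the gradient errors and
  tend to \<open>0\<close> in \<open>L^2\<close>; hence so do the maps themselves, and their limit
  is \<open>u\<close>.\<close>

lemma W12_0_eq_0_if_weak_D_eq_0:
  assumes \<Omega>: "open \<Omega>" "bounded \<Omega>" and u: "u \<in> W12_0 \<Omega>"
    and D: "AE x in lebesgue_on \<Omega>. weak_D \<Omega> u x = 0"
  shows "AE x in lebesgue_on \<Omega>. u x = 0"
proof -
  obtain \<phi> where \<phi>: "\<And>k::nat. \<phi> k \<in> smooth_compact \<Omega>"
    and s: "\<And>k. square_integrable \<Omega> (\<lambda>x. \<phi> k x - u x)"
      "\<And>k. square_integrable \<Omega> (\<lambda>x. jacobian (\<phi> k) (at x) - weak_D \<Omega> u x)"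
    and lim: "(\<lambda>k. LINT x|lebesgue_on \<Omega>. (norm (\<phi> k x - u x))\<^sup>2) \<longlonglongrightarrow> 0"
      "(\<lambda>k. LINT x|lebesgue_on \<Omega>. (norm (jacobian (\<phi> k) (at x) - weak_D \<Omega> u x))\<^sup>2) \<longlonglongrightarrow> 0"
    using W12_0_approx[OF \<Omega> u] by blast
  obtain L where L: "\<Omega> \<subseteq> cball 0 L" using bounded_subset_ballD[OF \<Omega>(2), of 0] ball_subset_cball by blast
  have us: "square_integrable \<Omega> u" using u by (auto simp: W12_0_def W12_def)
  let ?A = "\<lambda>k. LINT x|lebesgue_on \<Omega>. (norm (\<phi> k x - u x))\<^sup>2"
  let ?B = "\<lambda>k. LINT x|lebesgue_on \<Omega>. (norm (jacobian (\<phi> k) (at x) - weak_D \<Omega> u x))\<^sup>2"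
  have "AE x in lebesgue_on \<Omega>. u x $ i = 0" for i
  proof -
    have le: "(LINT x|lebesgue_on \<Omega>. (u x $ i)\<^sup>2) \<le> 2 * ?A k + 8 * L\<^sup>2 * ?B k" for k
    proof -
      obtain K where K: "compact K" "K \<subseteq> \<Omega>" "\<And>x. x \<notin> K \<Longrightarrow> \<phi> k x = 0" "Ck_on 1 (\<phi> k) UNIV"
        using smooth_compactD[OF \<phi>] by metis
      have \<phi>s: "square_integrable \<Omega> (\<phi> k)" "square_integrable \<Omega> (\<lambda>x. jacobian (\<phi> k) (at x))"
        by (intro square_integrable_continuous \<Omega> Ck_on_1_D[OF K(4)] continuous_on_jacobian K(4))+
      have "(LINT x|lebesgue_on \<Omega>. (\<phi> k x $ i)\<^sup>2) \<le>
          4 * L\<^sup>2 * (LINT x|lebesgue_on \<Omega>. (frechet_derivative (\<lambda>x. \<phi> k x $ i) (at x) (axis 1 1))\<^sup>2)"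
        using K by (intro poincare_inequality[OF \<Omega>(1) L C1_nth(3)]) auto
      also have "\<dots> = 4 * L\<^sup>2 * (LINT x|lebesgue_on \<Omega>. (jacobian (\<phi> k) (at x) $ i $ 1)\<^sup>2)"
        by (simp add: C1_nth(2)[OF K(4)])
      also have "\<dots> \<le> 4 * L\<^sup>2 * (LINT x|lebesgue_on \<Omega>. (norm (jacobian (\<phi> k) (at x)))\<^sup>2)"
        by (intro mult_left_mono square_integrable_entry(3)[OF \<phi>s(2)]) simp
      also have "(LINT x|lebesgue_on \<Omega>. (norm (jacobian (\<phi> k) (at x)))\<^sup>2) = ?B k"
      proof (rule integral_cong_AE)
        show "AE x in lebesgue_on \<Omega>. (norm (jacobian (\<phi> k) (at x)))\<^sup>2 =
            (norm (jacobian (\<phi> k) (at x) - weak_D \<Omega> u x))\<^sup>2"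
          using D by eventually_elim simp
      qed (use \<phi>s s(2) in \<open>auto simp: square_integrable_def\<close>)
      finally have p: "(LINT x|lebesgue_on \<Omega>. (\<phi> k x $ i)\<^sup>2) \<le> 4 * L\<^sup>2 * ?B k" .
      note i = square_integrable_nth[OF us, of i] square_integrable_nth[OF \<phi>s(1), of i]
        square_integrable_nth[OF s(1)[of k], of i]
      have "(LINT x|lebesgue_on \<Omega>. (u x $ i)\<^sup>2) \<le>
          (LINT x|lebesgue_on \<Omega>. 2 * (\<phi> k x $ i)\<^sup>2 + 2 * ((\<phi> k x - u x) $ i)\<^sup>2)"
      proof (rule integral_mono)
        show "(u x $ i)\<^sup>2 \<le> 2 * (\<phi> k x $ i)\<^sup>2 + 2 * ((\<phi> k x - u x) $ i)\<^sup>2" for x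
          using power2_norm_diff_le[of "\<phi> k x $ i" "(\<phi> k x - u x) $ i"] by simp
      qed (intro Bochner_Integration.integrable_add integrable_mult_right i)+
      also have "\<dots> = 2 * (LINT x|lebesgue_on \<Omega>. (\<phi> k x $ i)\<^sup>2) + 2 * (LINT x|lebesgue_on \<Omega>. ((\<phi> k x - u x) $ i)\<^sup>2)"
        using i by (subst Bochner_Integration.integral_add) (auto simp del: vector_minus_component)
      also have "\<dots> \<le> 2 * (4 * L\<^sup>2 * ?B k) + 2 * ?A k"
        using p i(9) by linarith
      finally show ?thesis by simp
    qed
    have "(\<lambda>k. 2 * ?A k + 8 * L\<^sup>2 * ?B k) \<longlonglongrightarrow> 2 * 0 + 8 * L\<^sup>2 * 0"
      by (intro tendsto_intros lim)
    then have "(LINT x|lebesgue_on \<Omega>. (u x $ i)\<^sup>2) \<le> 0"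
      using le by (intro LIMSEQ_le_const) auto
    then have "(LINT x|lebesgue_on \<Omega>. (u x $ i)\<^sup>2) = 0"
      by (intro antisym) auto
    then show ?thesis
      using integral_nonneg_eq_0_iff_AE[OF square_integrable_nth(2)[OF us, of i]] by simp
  qed
  then have "AE x in lebesgue_on \<Omega>. \<forall>i. u x $ i = 0" by (simp add: AE_all_countable)
  then show ?thesis by eventually_elim (simp add: vec_eq_iff)
qed

section \<open>Extension across the boundary\<close>

text \<open>A test function on \<open>T\<close> need not vanish near the frontier of
  \<open>\<Omega>\<close>, so the definition of the weak derivative on \<open>\<Omega>\<close> does
  not apply to it. Zero boundary values of \<open>u\<close> permit integration by parts against it
  all the same.\<close>

lemma W12_0_extend_by_zero:
  assumes \<Omega>: "open \<Omega>" "bounded \<Omega>" and T: "open T" "\<Omega> \<subseteq> T" and u: "u \<in> W12_0 \<Omega>"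
  shows "has_weak_derivative T (\<lambda>x. if x \<in> \<Omega> then u x else 0) (\<lambda>x. if x \<in> \<Omega> then weak_D \<Omega> u x else 0)"
  unfolding has_weak_derivative_def
proof (intro conjI ballI allI)
  have loc: "locally_integrable T (\<lambda>x. if x \<in> \<Omega> then f x else 0)" if "square_integrable \<Omega> f"
    for f :: "real^3 \<Rightarrow> 'b::euclidean_space"
  proof -
    have "integrable lebesgue (\<lambda>x. indicator \<Omega> x *\<^sub>R f x)"
      using square_integrable_imp_integrable[OF \<Omega> that] integrable_restrict_space[OF lebesgue_on_open[OF \<Omega>(1)]] by blast
    moreover have "(\<lambda>x. indicator \<Omega> x *\<^sub>R f x) = (\<lambda>x. if x \<in> \<Omega> then f x else 0)"
      by (auto simp: indicator_def)
    ultimately show ?thesis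
      by (auto simp: locally_integrable_def set_integrable_def compact_imp_closed intro!: integrable_mult_indicator)
  qed
  show "locally_integrable T (\<lambda>x. if x \<in> \<Omega> then u x else 0)"
    "locally_integrable T (\<lambda>x. if x \<in> \<Omega> then weak_D \<Omega> u x else 0)"
    using u by (auto intro!: loc simp: W12_0_def W12_def)
  fix \<phi> :: "real^3 \<Rightarrow> real" and i j :: 3
  assume "\<phi> \<in> smooth_compact T"
  then have \<phi>: "Ck_on 1 \<phi> UNIV" by (simp add: smooth_compact_def smooth_fun_on_def)
  have restr: "(LINT x|lebesgue_on T. f x) = (LINT x|lebesgue_on \<Omega>. f x)"
    if "\<And>x. x \<notin> \<Omega> \<Longrightarrow> f x = 0" for f :: "real^3 \<Rightarrow> real"
    unfolding integral_restrict_space[OF lebesgue_on_open[OF T(1)]] integral_restrict_space[OF lebesgue_on_open[OF \<Omega>(1)]]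
    using that T(2) by (intro Bochner_Integration.integral_cong) (auto simp: indicator_def)
  have "(LINT x|lebesgue_on T. (if x \<in> \<Omega> then u x else 0) $ i * frechet_derivative \<phi> (at x) (axis j 1)) =
      (LINT x|lebesgue_on \<Omega>. u x $ i * frechet_derivative \<phi> (at x) (axis j 1))"
    by (subst restr) (auto intro!: Bochner_Integration.integral_cong simp: space_restrict_space)
  also have "\<dots> = - (LINT x|lebesgue_on \<Omega>. weak_D \<Omega> u x $ i $ j * \<phi> x)"
    by (rule W12_0_integration_by_parts[OF \<Omega> u \<phi>])
  also have "(LINT x|lebesgue_on \<Omega>. weak_D \<Omega> u x $ i $ j * \<phi> x) =
      (LINT x|lebesgue_on T. (if x \<in> \<Omega> then weak_D \<Omega> u x else 0) $ i $ j * \<phi> x)"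
    by (subst restr) (auto intro!: Bochner_Integration.integral_cong simp: space_restrict_space)
  finally show "(LINT x|lebesgue_on T. (if x \<in> \<Omega> then u x else 0) $ i * frechet_derivative \<phi> (at x) (axis j 1)) =
      - (LINT x|lebesgue_on T. (if x \<in> \<Omega> then weak_D \<Omega> u x else 0) $ i $ j * \<phi> x)" .
qed

text \<open>The extension is \<open>g\<close> plus the zero extension of \<open>u - g\<close>, so no
  jump across the frontier of \<open>\<Omega>\<close> contributes to the weak derivative.\<close>

lemma weak_D_extend_by:
  assumes \<Omega>: "open \<Omega>" "bounded \<Omega>" and T: "open T" "\<Omega> \<subseteq> T" and g: "Ck_on 1 g UNIV"
    and u: "u \<in> W12 \<Omega>" "same_boundary_values \<Omega> u g"
  shows "AE x in lebesgue_on T. weak_D T (extend_by \<Omega> g u) x =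
    (if x \<in> \<Omega> then weak_D \<Omega> u x else jacobian g (at x))"
proof -
  let ?v = "\<lambda>x. u x - g x"
  have v: "?v \<in> W12_0 \<Omega>" using u(2) by (simp add: same_boundary_values_def)
  have u': "has_weak_derivative \<Omega> u (weak_D \<Omega> u)" using u(1) weak_D_works by (auto simp: W12_def)
  note e = W12_0_extend_by_zero[OF \<Omega> T v]
  \<comment> \<open>The sum \<open>g + v\<close> is written as \<open>g - (0 - v)\<close>, so that
    the rule for differences suffices.\<close>
  have "Ck_on 1 (\<lambda>x::real^3. 0::real^3) UNIV" by (rule Ck_on_const)
  from has_weak_derivative_diff[OF T(1) C1_has_weak_derivative[OF T(1) g]
      has_weak_derivative_diff[OF T(1) C1_has_weak_derivative[OF T(1) this] e]]
  have "has_weak_derivative T (\<lambda>x. g x - (0 - (if x \<in> \<Omega> then ?v x else 0)))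
      (\<lambda>x. jacobian g (at x) - (jacobian (\<lambda>x::real^3. 0::real^3) (at x) - (if x \<in> \<Omega> then weak_D \<Omega> ?v x else 0)))" .
  moreover have "(\<lambda>x. g x - (0 - (if x \<in> \<Omega> then ?v x else 0))) = extend_by \<Omega> g u"
    by (auto simp: extend_by_def)
  moreover have "jacobian (\<lambda>x::real^3. 0::real^3) (at x) = 0" for x
    by (simp add: vec_eq_iff jacobian_nth)
  ultimately have 1: "AE x in lebesgue_on T. weak_D T (extend_by \<Omega> g u) x =
      jacobian g (at x) + (if x \<in> \<Omega> then weak_D \<Omega> ?v x else 0)"
    using weak_D_AE_eq[OF T(1)] by simp
  have "AE x in lebesgue_on \<Omega>. weak_D \<Omega> ?v x = weak_D \<Omega> u x - jacobian g (at x)"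
    by (intro weak_D_AE_eq has_weak_derivative_diff \<Omega> u' C1_has_weak_derivative g)
  then have "AE x in lebesgue. x \<in> \<Omega> \<longrightarrow> weak_D \<Omega> ?v x = weak_D \<Omega> u x - jacobian g (at x)"
    by (subst (asm) AE_restrict_space_iff[OF lebesgue_on_open[OF \<Omega>(1)]])
  then have "AE x in lebesgue. x \<in> T \<longrightarrow> (x \<in> \<Omega> \<longrightarrow> weak_D \<Omega> ?v x = weak_D \<Omega> u x - jacobian g (at x))"
    by eventually_elim simp
  then have "AE x in lebesgue_on T. x \<in> \<Omega> \<longrightarrow> weak_D \<Omega> ?v x = weak_D \<Omega> u x - jacobian g (at x)"
    by (subst AE_restrict_space_iff[OF lebesgue_on_open[OF T(1)]])
  with 1 show ?thesis by eventually_elim auto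
qed

subsection \<open>The surface energy\<close>

text \<open>Squaring removes the corner of the positive part. The test fields of the surface energy
  are only \<open>C^1\<close>, so this replaces the smooth bumps in their construction.\<close>

lemma pos_square_has_real_derivative:
  "((\<lambda>s::real. (max 0 s)\<^sup>2) has_real_derivative 2 * max 0 s) (at s)"
proof -
  consider "s > 0" | "s < 0" | "s = 0" by linarith
  then show ?thesis
  proof cases
    case 1
    have "((\<lambda>s::real. s\<^sup>2) has_real_derivative 2 * max 0 s) (at s)"
      using 1 by (auto intro!: derivative_eq_intros)
    then show ?thesis
      by (rule has_field_derivative_transform_within_open[where S="{0<..}"]) (use 1 in auto)
  next
    case 2
    have "((\<lambda>s::real. 0) has_real_derivative 2 * max 0 s) (at s)"
      using 2 by simp
    then show ?thesis
      by (rule has_field_derivative_transform_within_open[where S="{..<0}"]) (use 2 in auto)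
  next
    case 3
    have "((\<lambda>h::real. (max 0 h)\<^sup>2 / h) \<longlongrightarrow> 0) (at 0)"
    proof (rule Lim_null_comparison)
      show "\<forall>\<^sub>F h::real in at 0. norm ((max 0 h)\<^sup>2 / h) \<le> \<bar>h\<bar>"
        by (auto simp: max_def power2_eq_square intro!: always_eventually)
      show "((\<lambda>h::real. \<bar>h\<bar>) \<longlongrightarrow> 0) (at 0)"
        by (intro tendsto_rabs_zero tendsto_ident_at)
    qed
    then show ?thesis using 3 by (simp add: DERIV_def)
  qed
qed

lemma C1_pos_square:
  assumes "Ck_on 1 f UNIV"
  shows "Ck_on 1 (\<lambda>x. (max 0 (f x :: real))\<^sup>2) UNIV"
proof -
  note df = Ck_on_1_D[OF assms]
  have "((\<lambda>x. (max 0 (f x))\<^sup>2) has_derivative (\<lambda>v. 2 * max 0 (f x) * frechet_derivative f (at x) v)) (at x)" for x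
    using has_derivative_compose[OF df(1) pos_square_has_real_derivative[unfolded has_field_derivative_def]] .
  then show ?thesis
    unfolding One_nat_def by (rule Ck_on_Suc_UNIV_I) (auto intro!: continuous_intros df)
qed

lemma C1_ball_bump:
  fixes p :: "'a::real_inner"
  shows "Ck_on 1 (\<lambda>x. (max 0 (r\<^sup>2 - (norm (x - p))\<^sup>2))\<^sup>2) UNIV"
proof (rule C1_pos_square)
  have "((\<lambda>x. r\<^sup>2 - (norm (x - p))\<^sup>2) has_derivative (\<lambda>v. - (2 * ((x - p) \<bullet> v)))) (at x)" for x
    unfolding power2_norm_eq_inner by (auto intro!: derivative_eq_intros simp: inner_commute)
  then show "Ck_on 1 (\<lambda>x. r\<^sup>2 - (norm (x - p))\<^sup>2) UNIV"
    unfolding One_nat_def by (rule Ck_on_Suc_UNIV_I) (auto intro!: continuous_intros)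
qed

text \<open>A finite sum \<open>\<sigma>\<close> of ball bumps is positive on \<open>K\<close>,
  hence at least some \<open>\<delta> > 0\<close> there by compactness, and it vanishes outside the
  balls. The function \<open>1 - (max 0 (1 - \<sigma> / \<delta>))^2\<close> is \<open>1\<close>
  where \<open>\<sigma> \<ge> \<delta>\<close> and \<open>0\<close> where
  \<open>\<sigma> = 0\<close>.\<close>

lemma C1_cutoff:
  fixes K S :: "'a::euclidean_space set"
  assumes K: "compact K" "K \<subseteq> S" and S: "open S"
  obtains \<phi> :: "'a \<Rightarrow> real" and L where "Ck_on 1 \<phi> UNIV" "compact L" "L \<subseteq> S"
    "\<And>x. x \<notin> L \<Longrightarrow> \<phi> x = 0" "\<And>x. x \<in> K \<Longrightarrow> \<phi> x = 1"
proof (cases "K = {}")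
  case True
  then show ?thesis using that[of "\<lambda>_. 0" "{}"] Ck_on_const by auto
next
  case False
  have "\<exists>r>0. cball p r \<subseteq> S" if "p \<in> K" for p
    using S K(2) that open_contains_cball by blast
  then obtain r where r: "\<And>p. p \<in> K \<Longrightarrow> r p > 0 \<and> cball p (r p) \<subseteq> S" by metis
  have "K \<subseteq> (\<Union>p\<in>K. ball p (r p))" using r by force
  then obtain F where F: "F \<subseteq> K" "finite F" "K \<subseteq> (\<Union>p\<in>F. ball p (r p))"
    using compactE_image[OF K(1), of K "\<lambda>p. ball p (r p)"] by auto
  define \<beta> where "\<beta> p x = (max 0 ((r p)\<^sup>2 - (norm (x - p))\<^sup>2))\<^sup>2" for p x
  define \<sigma> where "\<sigma> x = (\<Sum>p\<in>F. \<beta> p x)" for x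
  have \<sigma>: "Ck_on 1 \<sigma> UNIV"
    unfolding \<sigma>_def \<beta>_def by (intro Ck_on_sum C1_ball_bump)
  have pos: "\<sigma> x > 0" if "x \<in> K" for x
  proof -
    obtain p where p: "p \<in> F" "x \<in> ball p (r p)" using F(3) \<open>x \<in> K\<close> by blast
    then have "(norm (x - p))\<^sup>2 < (r p)\<^sup>2"
      by (intro power_strict_mono) (auto simp: dist_norm norm_minus_commute)
    then have "\<beta> p x > 0" by (simp add: \<beta>_def)
    moreover have "\<beta> p x \<le> \<sigma> x"
      unfolding \<sigma>_def by (rule member_le_sum[OF p(1)]) (auto simp: \<beta>_def F(2))
    ultimately show ?thesis by linarith
  qed
  have "continuous_on K \<sigma>" using Ck_on_1_D(3)[OF \<sigma>] continuous_on_subset by blast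
  then obtain x0 where x0: "x0 \<in> K" "\<And>x. x \<in> K \<Longrightarrow> \<sigma> x0 \<le> \<sigma> x"
    using continuous_attains_inf[OF K(1) False] by blast
  define \<delta> where "\<delta> = \<sigma> x0"
  have \<delta>: "\<delta> > 0" "\<And>x. x \<in> K \<Longrightarrow> \<delta> \<le> \<sigma> x" using pos x0 by (auto simp: \<delta>_def)
  \<comment> \<open>Written with sums and products only, so that the closure rules for
    \<open>Ck_on\<close> apply directly.\<close>
  define \<phi> where "\<phi> x = 1 + (- 1) * (max 0 (1 + (- (1 / \<delta>)) * \<sigma> x))\<^sup>2" for x
  let ?L = "\<Union>p\<in>F. cball p (r p)"
  show ?thesis
  proof (rule that)
    show "Ck_on 1 \<phi> UNIV"
      unfolding \<phi>_def by (intro Ck_on_add Ck_on_mult C1_pos_square Ck_on_const \<sigma>)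
    show "compact ?L" using F(2) by (intro compact_UN) auto
    show "?L \<subseteq> S" using r F(1) by blast
    show "\<phi> x = 0" if "x \<notin> ?L" for x
    proof -
      have "\<beta> p x = 0" if p: "p \<in> F" for p
      proof -
        have "r p < norm (x - p)" using \<open>x \<notin> ?L\<close> p by (auto simp: dist_norm norm_minus_commute)
        then have "(r p)\<^sup>2 \<le> (norm (x - p))\<^sup>2"
          using r[of p] F(1) p by (intro power_mono) force+
        then show ?thesis by (simp add: \<beta>_def)
      qed
      then show ?thesis by (simp add: \<phi>_def \<sigma>_def)
    qed
    show "\<phi> x = 1" if "x \<in> K" for x
    proof -
      have "1 + (- (1 / \<delta>)) * \<sigma> x \<le> 0" using \<delta>(1) \<delta>(2)[OF that] by (simp add: field_simps)
      then show ?thesis unfolding \<phi>_def by (simp add: max_def)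
    qed
  qed
qed

section \<open>The integrand of the surface energy and its linearity\<close>

text \<open>The gradient field \<open>D\<close> is an argument of its own, so that
  \<open>weak_D\<close> can be exchanged for an explicit gradient pointwise. The map
  \<open>w\<close> enters only through its value at \<open>x\<close>.\<close>

definition surface_density ::
  "(real^3 \<Rightarrow> real^3) \<Rightarrow> (real^3 \<Rightarrow> real^3^3) \<Rightarrow> ((real^3) \<times> (real^3) \<Rightarrow> real^3) \<Rightarrow> real^3 \<Rightarrow> real" where
  "surface_density w D f x =
     trace (transpose (cof (D x)) ** jacobian (\<lambda>x'. f (x', w x)) (at x)) +
     det (D x) * trace (jacobian (\<lambda>y. f (x, y)) (at (w x)))"

lemma partial_derivatives:
  fixes f :: "(real^3) \<times> (real^3) \<Rightarrow> real^3"
  assumes "Ck_on 1 f UNIV"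
  shows "((\<lambda>x'. f (x', y)) has_derivative (\<lambda>v. frechet_derivative f (at (x, y)) (v, 0))) (at x)"
    and "((\<lambda>y'. f (x, y')) has_derivative (\<lambda>v. frechet_derivative f (at (x, y)) (0, v))) (at y)"
proof -
  note df = Ck_on_1_D[OF assms]
  have "((\<lambda>x'. (x', y)) has_derivative (\<lambda>v. (v, 0))) (at x)"
    and "((\<lambda>y'. (x, y')) has_derivative (\<lambda>v. (0, v))) (at y)"
    by (auto intro!: derivative_eq_intros)
  then show "((\<lambda>x'. f (x', y)) has_derivative (\<lambda>v. frechet_derivative f (at (x, y)) (v, 0))) (at x)"
    and "((\<lambda>y'. f (x, y')) has_derivative (\<lambda>v. frechet_derivative f (at (x, y)) (0, v))) (at y)"
    using has_derivative_compose[OF _ df(1)] by blast+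
qed

lemma jacobian_eqI:
  assumes "(f has_derivative f') (at x)"
  shows "jacobian f (at x) $ i $ j = f' (axis j 1) $ i"
  using frechet_derivative_at[OF assms] by (simp add: jacobian_nth)

lemma trace_transpose_mult: "trace (transpose (A::real^3^3) ** B) = (\<Sum>i\<in>UNIV. \<Sum>j\<in>UNIV. A $ i $ j * B $ i $ j)"
  unfolding trace_def matrix_matrix_mult_def transpose_def vec_lambda_beta by (rule sum.swap)

lemma surface_density_scaleR:
  assumes f: "Ck_on 1 f UNIV"
  shows "surface_density w D (\<lambda>z. c *\<^sub>R f z) x = c * surface_density w D f x"
proof -
  note p = partial_derivatives[OF f]
  have j1: "jacobian (\<lambda>x'. c *\<^sub>R f (x', w x)) (at x) $ i $ j = c * jacobian (\<lambda>x'. f (x', w x)) (at x) $ i $ j"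
    and j2: "jacobian (\<lambda>y. c *\<^sub>R f (x, y)) (at (w x)) $ i $ j = c * jacobian (\<lambda>y. f (x, y)) (at (w x)) $ i $ j" for i j
    by (simp_all add: jacobian_eqI[OF p(1)] jacobian_eqI[OF p(2)]
        jacobian_eqI[OF has_derivative_scaleR_right[OF p(1)]] jacobian_eqI[OF has_derivative_scaleR_right[OF p(2)]])
  show ?thesis
    unfolding surface_density_def trace_transpose_mult
    by (simp add: trace_def j1 j2 sum_distrib_left algebra_simps)
qed

lemma C1_compact_scaleR:
  assumes "f \<in> C1_compact S"
  shows "(\<lambda>z. c *\<^sub>R f z) \<in> C1_compact S"
proof -
  have sub: "supp (\<lambda>z. c *\<^sub>R f z) \<subseteq> supp f"
    unfolding supp_def by (intro closure_mono) auto
  have "compact (supp f)" using assms by (simp add: C1_compact_def)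
  then have "compact (supp (\<lambda>z. c *\<^sub>R f z))"
    using compact_Int_closed[of "supp f" "supp (\<lambda>z. c *\<^sub>R f z)"] sub
    by (simp add: Int_absorb1 supp_def)
  moreover have "Ck_on 1 (\<lambda>z. c *\<^sub>R f z) UNIV"
    by (intro Ck_on_scaleR Ck_on_const) (use assms in \<open>simp add: C1_compact_def\<close>)
  ultimately show ?thesis using assms sub by (auto simp: C1_compact_def)
qed

lemma C1_compact_eq_0: "f \<in> C1_compact S \<Longrightarrow> z \<notin> supp f \<Longrightarrow> f z = 0"
  using closure_subset[of "{x. f x \<noteq> 0}"] by (auto simp: supp_def)

text \<open>After scaling by the bound \<open>B\<close>, both \<open>f / B\<close> and
  \<open>- f / B\<close> compete in the supremum. The integral is linear under scaling, so it is
  bounded above by \<open>0\<close> with either sign.\<close>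

lemma surface_energy_eq_0D:
  assumes E: "surface_energy T w = 0" and f: "f \<in> C1_compact (T \<times> UNIV)"
  shows "(LINT x|lebesgue_on T. surface_density w (weak_D T w) f x) = 0"
proof -
  have C1: "Ck_on 1 f UNIV" and c: "compact (supp f)" using f by (auto simp: C1_compact_def)
  have "compact (f ` supp f)"
    using Ck_on_1_D(3)[OF C1] c by (intro compact_continuous_image) (auto intro: continuous_on_subset)
  then obtain B where B: "B > 0" "\<And>z. z \<in> supp f \<Longrightarrow> norm (f z) \<le> B"
    using compact_imp_bounded bounded_pos by (metis imageI)
  have bound: "norm (f z) \<le> B" for z
    using B C1_compact_eq_0[OF f, of z] by (cases "z \<in> supp f") auto
  have le: "s * (LINT x|lebesgue_on T. surface_density w (weak_D T w) f x) \<le> 0" if s: "\<bar>s\<bar> = 1 / B" for s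
  proof -
    let ?f = "\<lambda>z. s *\<^sub>R f z"
    have "norm (?f z) \<le> 1" for z
      using mult_left_mono[OF bound, of "\<bar>s\<bar>" z] B(1) s by simp
    then have "?f \<in> {f \<in> C1_compact (T \<times> UNIV). \<forall>z. norm (f z) \<le> 1}"
      using C1_compact_scaleR[OF f] by blast
    then have "ereal (LINT x|lebesgue_on T. surface_density w (weak_D T w) ?f x) \<le> surface_energy T w"
      unfolding surface_energy_def surface_density_def by (rule SUP_upper)
    then show ?thesis using E by (simp add: surface_density_scaleR[OF C1])
  qed
  show ?thesis using le[of "1 / B"] le[of "- (1 / B)"] B(1) by (simp add: field_simps)
qed

lemma jacobian_affine:
  "jacobian (\<lambda>x. lam *\<^sub>R x + b) (at x) = lam *\<^sub>R mat 1" for b :: "real^3"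
proof -
  have "((\<lambda>x. lam *\<^sub>R x + b) has_derivative (\<lambda>v. lam *\<^sub>R v)) (at x)"
    by (auto intro!: derivative_eq_intros)
  from jacobian_eqI[OF this] show ?thesis by (simp add: vec_eq_iff mat_def axis_def)
qed

lemma C1_affine: "Ck_on k (\<lambda>x::real^3. lam *\<^sub>R x + b) UNIV"
  by (intro Ck_on_add Ck_on_const Ck_on_bounded_linear bounded_linear_scaleR_right)

lemma cof_scaled_mat: "cof (c *\<^sub>R mat 1) = c\<^sup>2 *\<^sub>R mat 1"
  by (simp add: vec_eq_iff cof_def det_3 mat_def axis_def forall_3 power2_eq_square)

lemma det_scaled_mat: "det (c *\<^sub>R mat 1 :: real^3^3) = c ^ 3"
  by (simp add: det_3 mat_def power3_eq_cube)

text \<open>Here the cofactor is \<open>lam^2\<close> and the determinant \<open>lam^3\<close> times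
  the identity and \<open>1\<close> respectively, so the density is
  \<open>lam^2 (div_x f + lam div_y f)\<close>. By the chain rule this is \<open>lam^2\<close> times
  the divergence of \<open>f (x, g x)\<close>, a field with compact support in
  \<open>T\<close>.\<close>

lemma surface_density_affine:
  fixes f :: "(real^3) \<times> (real^3) \<Rightarrow> real^3" and g :: "real^3 \<Rightarrow> real^3"
  assumes g_def: "g = (\<lambda>x. lam *\<^sub>R x + b)" 
    and T: "open T" and f: "f \<in> C1_compact (T \<times> UNIV)" and D: "D x = lam *\<^sub>R mat 1"
  shows "surface_density g D f x = lam\<^sup>2 * trace (jacobian (\<lambda>x. f (x, g x)) (at x))"
    and "continuous_on UNIV (\<lambda>x. lam\<^sup>2 * trace (jacobian (\<lambda>x. f (x, g x)) (at x)))"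
    and "(LINT x|lebesgue_on T. lam\<^sup>2 * trace (jacobian (\<lambda>x. f (x, g x)) (at x))) = 0"
proof -
  have C1: "Ck_on 1 f UNIV" and c: "compact (supp f)" "supp f \<subseteq> T \<times> UNIV" using f by (auto simp: C1_compact_def)
  note df = Ck_on_1_D[OF C1] and p = partial_derivatives[OF C1]
  let ?h = "\<lambda>x. f (x, g x)"
  have cg: "continuous_on UNIV g" unfolding g_def by (intro continuous_intros)
  have dg: "((\<lambda>x. (x, g x)) has_derivative (\<lambda>v. (v, lam *\<^sub>R v))) (at x)" for x
    unfolding g_def by (auto intro!: derivative_eq_intros)
  have dh: "(?h has_derivative (\<lambda>v. frechet_derivative f (at (x, g x)) (v, lam *\<^sub>R v))) (at x)" for x
    using has_derivative_compose[OF dg df(1)] .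
  have h: "Ck_on 1 ?h UNIV"
    unfolding One_nat_def
  proof (rule Ck_on_Suc_UNIV_I[OF dh])
    show "Ck_on 0 (\<lambda>x. frechet_derivative f (at (x, g x)) (v, lam *\<^sub>R v)) UNIV" for v
      using continuous_on_compose2[OF df(2), of UNIV "\<lambda>x. (x, g x)" "(v, lam *\<^sub>R v)"] cg
      by (simp add: continuous_on_Pair)
  qed
  have split: "frechet_derivative f (at (x, y)) (v, lam *\<^sub>R v) =
      frechet_derivative f (at (x, y)) (v, 0) + lam *\<^sub>R frechet_derivative f (at (x, y)) (0, v)" for x y v
  proof -
    have lin: "linear (frechet_derivative f (at (x, y)))" using df(1) has_derivative_linear by blast
    have "(v, lam *\<^sub>R v) = (v, 0) + lam *\<^sub>R (0, v)" by simp
    then show ?thesis by (simp only: linear_add[OF lin] linear_cmul[OF lin])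
  qed
  have j: "jacobian ?h (at x) $ i $ i = jacobian (\<lambda>x'. f (x', g x)) (at x) $ i $ i +
      lam * jacobian (\<lambda>y. f (x, y)) (at (g x)) $ i $ i" for i
    by (simp add: jacobian_eqI[OF dh] jacobian_eqI[OF p(1)] jacobian_eqI[OF p(2)] split)
  have "trace (transpose (c *\<^sub>R mat 1 :: real^3^3) ** J) = c * trace J" for c and J :: "real^3^3"
    unfolding trace_transpose_mult by (simp add: trace_def mat_def sum_3 algebra_simps)
  then show "surface_density g D f x = lam\<^sup>2 * trace (jacobian ?h (at x))"
    by (simp add: surface_density_def D cof_scaled_mat det_scaled_mat trace_def j sum.distrib
        sum_distrib_left algebra_simps power2_eq_square power3_eq_cube)
  show cont: "continuous_on UNIV (\<lambda>x. lam\<^sup>2 * trace (jacobian ?h (at x)))"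
    unfolding trace_def by (intro continuous_intros continuous_on_component continuous_on_jacobian h)
  let ?K = "fst ` supp f"
  have K: "compact ?K" "?K \<subseteq> T"
    using c by (auto intro!: compact_continuous_image continuous_intros)
  have h0: "?h x = 0" if "x \<notin> ?K" for x
  proof -
    have "(x, g x) \<notin> supp f" using that by force
    then show ?thesis using C1_compact_eq_0[OF f] by blast
  qed
  have cj: "continuous_on UNIV (\<lambda>x. jacobian ?h (at x) $ i $ i)" for i
    by (intro continuous_on_component continuous_on_jacobian h)
  have zero: "(LINT x|lebesgue_on T. jacobian ?h (at x) $ i $ i) = 0" for i
    unfolding jacobian_nth
    by (rule integral_lebesgue_on_derivative_eq_0[OF T C1_nth(1)[OF h] _ K])
      (use h0 Ck_on_1_D(2)[OF h] in \<open>auto intro: continuous_on_component\<close>)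
  have int: "integrable (lebesgue_on T) (\<lambda>x. jacobian ?h (at x) $ i $ i)" for i
  proof -
    have "jacobian ?h (at x) $ i $ i = 0" if "x \<notin> ?K" for x
      unfolding jacobian_nth
      using has_derivative_outside_support[OF Ck_on_1_D(1)[OF h] compact_imp_closed[OF K(1)] h0 that]
      by simp
    then have "integrable (lebesgue_on T) (\<lambda>x. 1 * jacobian ?h (at x) $ i $ i)"
      using continuous_imp_locally_integrable[of "\<lambda>_. 1::real" UNIV] K(1)
      by (intro integrable_lebesgue_on_mult_compact_support[OF T K] cj)
        (auto simp: locally_integrable_def)
    then show ?thesis by simp
  qed
  show "(LINT x|lebesgue_on T. lam\<^sup>2 * trace (jacobian ?h (at x))) = 0"
    unfolding trace_def using int by (simp add: Bochner_Integration.integral_sum zero)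
qed

lemma weak_D_affine:
  fixes lam :: real and b :: "real^3"
  assumes "open T"
  shows "AE x in lebesgue_on T. weak_D T (\<lambda>x. lam *\<^sub>R x + b) x = lam *\<^sub>R mat 1"
  using weak_D_AE_eq[OF assms C1_has_weak_derivative[OF assms C1_affine]] by (simp add: jacobian_affine)

lemma surface_density_weak_D_affine:
  assumes g_def: "g = (\<lambda>x::real^3. lam *\<^sub>R x + b)"
    and T: "open T" "bounded T" and f: "f \<in> C1_compact (T \<times> UNIV)"
  shows "integrable (lebesgue_on T) (surface_density g (weak_D T g) f)"
    and "(LINT x|lebesgue_on T. surface_density g (weak_D T g) f x) = 0"
proof -
  let ?d = "\<lambda>x. lam\<^sup>2 * trace (jacobian (\<lambda>x. f (x, g x)) (at x))"
  note d = surface_density_affine[OF g_def T(1) f]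
  \<comment> \<open>The last two conclusions do not mention \<open>D\<close>, so the constant
    gradient field serves to discharge the hypothesis on it.\<close>
  have cont: "continuous_on UNIV ?d" and zero: "(LINT x|lebesgue_on T. ?d x) = 0"
    using d(2,3)[of "\<lambda>_. lam *\<^sub>R mat 1"] by auto
  have AE: "AE x in lebesgue_on T. surface_density g (weak_D T g) f x = ?d x"
    using weak_D_affine[OF T(1), of lam b, folded g_def] by eventually_elim (rule d(1))
  have m: "?d \<in> borel_measurable (lebesgue_on T)"
    by (rule borel_measurable_lebesgue_on_continuous[OF cont])
  have m': "surface_density g (weak_D T g) f \<in> borel_measurable (lebesgue_on T)"
    by (rule borel_measurable_lebesgue_on_AE[OF T(1) m]) (use AE in eventually_elim, simp)
  show "integrable (lebesgue_on T) (surface_density g (weak_D T g) f)"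
    using integrable_lebesgue_on_continuous[OF cont T(2,1)] integrable_cong_AE[OF m' m AE] by blast
  show "(LINT x|lebesgue_on T. surface_density g (weak_D T g) f x) = 0"
    using integral_cong_AE[OF m' m AE] zero by simp
qed

lemma surface_energy_affine:
  fixes lam :: real and b :: "real^3"
  assumes T: "open T" "bounded T"
  shows "surface_energy T (\<lambda>x. lam *\<^sub>R x + b) = 0"
proof -
  let ?F = "{f \<in> C1_compact (T \<times> UNIV). \<forall>z::(real^3) \<times> (real^3). norm (f z :: real^3) \<le> 1}"
  let ?g = "\<lambda>x. lam *\<^sub>R x + b"
  \<comment> \<open>Over an empty set of test fields the supremum would be
    \<open>-\<infinity>\<close> instead of \<open>0\<close>.\<close>
  have "(\<lambda>_. 0) \<in> ?F" by (simp add: C1_compact_def supp_def Ck_on_const del: Ck_on.simps)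
  then have ne: "?F \<noteq> {}" by blast
  have "surface_energy T ?g = (SUP f\<in>?F. ereal (LINT x|lebesgue_on T. surface_density ?g (weak_D T ?g) f x))"
    by (simp add: surface_energy_def surface_density_def)
  also have "\<dots> = (SUP f\<in>?F. 0)"
    by (intro SUP_cong) (use surface_density_weak_D_affine(2)[OF refl T] in auto)
  also have "\<dots> = 0" by (rule SUP_const[OF ne])
  finally show ?thesis .
qed

subsection \<open>The energy estimate\<close>

text \<open>\<open>W12\<close> refers to the chosen \<open>weak_D\<close>; square integrability of
  any exhibited weak derivative carries over to it.\<close>

lemma W12_I:
  assumes S: "open S" and u: "square_integrable S u" "has_weak_derivative S u G" "square_integrable S G"
  shows "u \<in> W12 S" and "(LINT x|lebesgue_on S. (norm (weak_D S u x))\<^sup>2) = (LINT x|lebesgue_on S. (norm (G x))\<^sup>2)"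
proof -
  have AE: "AE x in lebesgue_on S. weak_D S u x = G x" by (rule weak_D_AE_eq[OF S u(2)])
  have m: "G \<in> borel_measurable (lebesgue_on S)" using u(3) by (simp add: square_integrable_def)
  have m': "weak_D S u \<in> borel_measurable (lebesgue_on S)"
    by (rule borel_measurable_lebesgue_on_AE[OF S m]) (use AE in eventually_elim, simp)
  have sq: "AE x in lebesgue_on S. (norm (weak_D S u x))\<^sup>2 = (norm (G x))\<^sup>2"
    using AE by eventually_elim simp
  have mm: "(\<lambda>x. (norm (weak_D S u x))\<^sup>2) \<in> borel_measurable (lebesgue_on S)"
      "(\<lambda>x. (norm (G x))\<^sup>2) \<in> borel_measurable (lebesgue_on S)"
    using m m' by measurable
  have "integrable (lebesgue_on S) (\<lambda>x. (norm (weak_D S u x))\<^sup>2)"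
    using integrable_cong_AE[OF mm sq] u(3) by (simp add: square_integrable_def)
  then show "u \<in> W12 S" using u m' by (auto simp: W12_def square_integrable_def)
  show "(LINT x|lebesgue_on S. (norm (weak_D S u x))\<^sup>2) = (LINT x|lebesgue_on S. (norm (G x))\<^sup>2)"
    by (rule integral_cong_AE[OF mm sq])
qed

lemma W12_0_zero:
  assumes S: "open S" "bounded S"
  shows "(\<lambda>_. 0) \<in> W12_0 S"
proof -
  have C1: "Ck_on 1 (\<lambda>x::real^3. 0::real^3) UNIV" by (rule Ck_on_const)
  have "jacobian (\<lambda>x::real^3. 0::real^3) (at x) = 0" for x
    by (simp add: vec_eq_iff jacobian_nth)
  then have wd: "has_weak_derivative S (\<lambda>_. 0) (\<lambda>_. 0)"
    using C1_has_weak_derivative[OF S(1) C1] by simp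
  have sq: "square_integrable S (\<lambda>_. 0 :: real^3)" "square_integrable S (\<lambda>_. 0 :: real^3^3)"
    by (intro square_integrable_continuous S continuous_intros)+
  note W = W12_I[OF S(1) sq(1) wd sq(2)]
  have "W12_norm S (\<lambda>x. 0) = 0" using W(2) by (simp add: W12_norm_def)
  moreover have "(\<lambda>_. 0 :: real^3) \<in> smooth_compact S"
    by (simp add: smooth_compact_def smooth_fun_on_def supp_def Ck_on_const)
  ultimately show ?thesis
    using W(1) by (auto simp: W12_0_def intro!: exI[of _ "\<lambda>_ _. 0"])
qed

lemma Linf_norm_leD: "Linf_norm S u \<le> ereal M \<Longrightarrow> AE x in lebesgue_on S. norm (u x) \<le> M"
  using esssup_AE[of "\<lambda>x. ereal (norm (u x))" "lebesgue_on S"]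
  by (auto simp: Linf_norm_def elim!: eventually_mono dest: order_trans)

lemma affine_admissible_ncb:
  assumes \<Omega>: "open \<Omega>" "bounded \<Omega>" and T: "open T" "bounded T" and lam: "lam > 0"
    and g: "g = (\<lambda>x. lam *\<^sub>R x + b)" and M: "Linf_norm \<Omega> g \<le> ereal M"
  shows "g \<in> admissible_ncb \<Omega> T g M"
proof -
  have wd: "has_weak_derivative \<Omega> g (\<lambda>_. lam *\<^sub>R mat 1)"
    using C1_has_weak_derivative[OF \<Omega>(1) C1_affine] unfolding jacobian_affine g .
  have "square_integrable \<Omega> g" "square_integrable \<Omega> (\<lambda>_. lam *\<^sub>R mat 1 :: real^3^3)"
    unfolding g by (intro square_integrable_continuous \<Omega> continuous_intros)+
  with wd have "g \<in> W12 \<Omega>" by (intro W12_I(1)[OF \<Omega>(1)])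
  moreover have "same_boundary_values \<Omega> g g"
    using W12_0_zero[OF \<Omega>] by (simp add: same_boundary_values_def)
  moreover have "AE x in lebesgue_on \<Omega>. det (weak_D \<Omega> g x) > 0"
    using weak_D_AE_eq[OF \<Omega>(1) wd] by eventually_elim (simp add: det_scaled_mat lam)
  moreover have "injective_ae \<Omega> g"
    unfolding injective_ae_def using lam by (intro exI[of _ "{}"]) (auto simp: g inj_on_def)
  moreover have "extend_by \<Omega> g g = g" by (auto simp: extend_by_def)
  ultimately show ?thesis
    using M surface_energy_affine[OF T, of lam b] by (simp add: admissible_ncb_def admissible_def g)
qed

text \<open>Varying either variable alone, the field is constant in \<open>x\<close> and equal to
  \<open>y\<close> in a neighbourhood: \<open>\<Omega>\<close> is open, and the strict bound on
  \<open>w x\<close> keeps nearby points \<open>y\<close> in the region where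
  \<open>\<eta> = 1\<close>. So the cofactor term drops out and the divergence in \<open>y\<close>
  is \<open>3\<close>.\<close>

lemma surface_density_radial:
  fixes \<phi> \<eta> :: "real^3 \<Rightarrow> real"
  assumes \<Omega>: "open \<Omega>" "x \<in> \<Omega>" "\<And>x. x \<in> \<Omega> \<Longrightarrow> \<phi> x = 1"
    and w: "norm (w x) < R" "\<And>y. norm y \<le> R \<Longrightarrow> \<eta> y = 1"
  shows "surface_density w D (\<lambda>(x, y). (\<phi> x * \<eta> y) *\<^sub>R y) x = 3 * det (D x)"
proof -
  have "((\<lambda>_. \<eta> (w x) *\<^sub>R w x) has_derivative (\<lambda>_. 0)) (at x)" by simp
  then have 1: "((\<lambda>x'. (\<phi> x' * \<eta> (w x)) *\<^sub>R w x) has_derivative (\<lambda>_. 0)) (at x)"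
    by (rule has_derivative_transform_within_open[OF _ \<Omega>(1,2)]) (simp add: \<Omega>(3))
  have "((\<lambda>y. y) has_derivative (\<lambda>v. v)) (at (w x))" by simp
  then have 2: "((\<lambda>y. (\<phi> x * \<eta> y) *\<^sub>R y) has_derivative (\<lambda>v. v)) (at (w x))"
    by (rule has_derivative_transform_within_open[where s="ball 0 R"]) (use \<Omega> w in auto)
  show ?thesis
    unfolding surface_density_def trace_transpose_mult
    by (simp add: trace_def jacobian_eqI[OF 1] jacobian_eqI[OF 2])
qed

text \<open>
  The surface densities of \<open>u\<^sup>e\<close> and \<open>g\<close> agree on \<open>T - \<Omega>\<close> and are \<open>3 det Du\<close> and \<open>3 \<lambda>\<^sup>3\<close> on \<open>\<Omega>\<close>.
\<close>

lemma integral_det_eq: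
  assumes \<Omega>: "open \<Omega>" "bounded \<Omega>" and T: "open T" "bounded T" "closure \<Omega> \<subseteq> T"
    and g: "g = (\<lambda>x. lam *\<^sub>R x + b)"
    and u: "u \<in> W12 \<Omega>" "same_boundary_values \<Omega> u g" "Linf_norm \<Omega> u \<le> ereal M"
    and E: "surface_energy T (extend_by \<Omega> g u) = 0"
    and int: "integrable (lebesgue_on \<Omega>) (\<lambda>x. det (weak_D \<Omega> u x))"
  shows "(LINT x|lebesgue_on \<Omega>. det (weak_D \<Omega> u x) - lam ^ 3) = 0"
proof -
  have \<Omega>T: "\<Omega> \<subseteq> T" using T(3) closure_subset by blast
  have "continuous_on (closure T) g" unfolding g by (intro continuous_intros)
  then have "compact (g ` closure T)"
    using T(2) by (intro compact_continuous_image) simp_all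
  then obtain B where B: "\<And>x. x \<in> T \<Longrightarrow> norm (g x) \<le> B"
    using compact_imp_bounded bounded_iff closure_subset by (metis (no_types, lifting) imageI subsetD)
  \<comment> \<open>Strictly larger than the essential bound \<open>M\<close> of \<open>u\<close>
    and the bound \<open>B\<close> of \<open>g\<close> on \<open>T\<close>, so that the cutoff in
    \<open>y\<close> is invisible to both maps.\<close>
  define R where "R = max M B + 1"
  obtain \<phi> :: "real^3 \<Rightarrow> real" and L where \<phi>: "Ck_on 1 \<phi> UNIV" "compact L" "L \<subseteq> T"
      "\<And>x. x \<notin> L \<Longrightarrow> \<phi> x = 0" "\<And>x. x \<in> closure \<Omega> \<Longrightarrow> \<phi> x = 1"
    using C1_cutoff[of "closure \<Omega>" T] \<Omega>(2) T(1,3) by (metis compact_closure)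
  obtain \<eta> :: "real^3 \<Rightarrow> real" and L' where \<eta>: "Ck_on 1 \<eta> UNIV" "compact L'"
      "\<And>x. x \<notin> L' \<Longrightarrow> \<eta> x = 0" "\<And>x. x \<in> cball 0 R \<Longrightarrow> \<eta> x = 1"
    using C1_cutoff[OF compact_cball subset_UNIV open_UNIV, of 0 R] by metis
  define f :: "(real^3) \<times> (real^3) \<Rightarrow> real^3" where "f = (\<lambda>(x, y). (\<phi> x * \<eta> y) *\<^sub>R y)"
  have f: "f \<in> C1_compact (T \<times> UNIV)"
  proof -
    have f_eq: "f = (\<lambda>z. (\<phi> (fst z + 0) * \<eta> (snd z + 0)) *\<^sub>R snd z)"
      by (auto simp: f_def)
    have "Ck_on 1 f UNIV"
      unfolding f_eq
      by (intro Ck_on_scaleR Ck_on_mult Ck_on_compose_affine \<phi> \<eta> bounded_linear_fst bounded_linear_snd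
          Ck_on_bounded_linear)
    moreover have c: "compact (L \<times> L')" using \<phi>(2) \<eta>(2) by (rule compact_Times)
    moreover have "supp f \<subseteq> L \<times> L'"
      unfolding supp_def using compact_imp_closed[OF c]
      by (rule closure_minimal[rotated]) (use \<phi>(4) \<eta>(3) in \<open>force simp: f_def\<close>)
    moreover have "compact (supp f)"
      using c \<open>supp f \<subseteq> L \<times> L'\<close> compact_Int_closed[OF c, of "supp f"]
      by (simp add: Int_absorb1 supp_def)
    ultimately show ?thesis using \<phi>(3) by (auto simp: C1_compact_def)
  qed
  let ?w = "extend_by \<Omega> g u"
  let ?dw = "surface_density ?w (weak_D T ?w) f" and ?dg = "surface_density g (weak_D T g) f"
  let ?d = "\<lambda>x. if x \<in> \<Omega> then 3 * (det (weak_D \<Omega> u x) - lam ^ 3) else 0"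
  note dg = surface_density_weak_D_affine[OF g T(1,2) f]
  have on_\<Omega>: "surface_density v D f x = 3 * det (D x)" if "x \<in> \<Omega>" "norm (v x) < R" for v D x
    unfolding f_def
    by (rule surface_density_radial[where w=v and x=x, OF \<Omega>(1) that(1) _ that(2)])
      (use \<phi>(5) \<eta>(4) closure_subset[of \<Omega>] in auto)
  have "Ck_on 1 g UNIV" unfolding g by (rule C1_affine)
  note Dw = weak_D_extend_by[OF \<Omega> T(1) \<Omega>T this u(1,2)]
  have Dg: "AE x in lebesgue_on T. weak_D T g x = lam *\<^sub>R mat 1"
    unfolding g by (rule weak_D_affine[OF T(1)])
  have "AE x in lebesgue. x \<in> \<Omega> \<longrightarrow> norm (u x) \<le> M"
    using Linf_norm_leD[OF u(3)] by (subst (asm) AE_restrict_space_iff[OF lebesgue_on_open[OF \<Omega>(1)]])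
  then have "AE x in lebesgue. x \<in> T \<longrightarrow> x \<in> \<Omega> \<longrightarrow> norm (u x) \<le> M"
    by eventually_elim simp
  then have uM: "AE x in lebesgue_on T. x \<in> \<Omega> \<longrightarrow> norm (u x) \<le> M"
    by (subst AE_restrict_space_iff[OF lebesgue_on_open[OF T(1)]])
  have "AE x in lebesgue_on T. x \<in> T"
    by (intro AE_I2) (simp add: space_restrict_space)
  with Dw Dg uM have AE: "AE x in lebesgue_on T. ?dg x + ?d x = ?dw x"
  proof eventually_elim
    case (elim x)
    show ?case
    proof (cases "x \<in> \<Omega>")
      case True
      have "norm (g x) < R" using B[OF elim(4)] by (simp add: R_def)
      moreover have "norm (?w x) < R" using elim(3) True by (simp add: R_def extend_by_def)
      ultimately show ?thesis
        using True elim(1,2) by (simp add: on_\<Omega> det_scaled_mat)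
    next
      case False
      \<comment> \<open>Both densities use only the values of map and gradient at \<open>x\<close>,
        and these agree; points on the frontier of \<open>\<Omega>\<close> are included.\<close>
      have "jacobian g (at x) = lam *\<^sub>R mat 1" unfolding g by (rule jacobian_affine)
      then show ?thesis
        using False elim(1,2) by (simp add: surface_density_def extend_by_def)
    qed
  qed
  \<comment> \<open>Integrability of the determinant is used here: it permits the later splitting of
    the integral of \<open>?dg + ?d\<close>.\<close>
  have "integrable (lebesgue_on \<Omega>) (\<lambda>x. 3 * (det (weak_D \<Omega> u x) - lam ^ 3))"
    using integrable_lebesgue_on_continuous[of "\<lambda>_. lam ^ 3" \<Omega>] \<Omega>
    by (intro integrable_mult_right Bochner_Integration.integrable_diff int) simp
  then have d: "integrable (lebesgue_on T) ?d"
    by (subst integral_restrict_if(2)[OF \<Omega>(1) T(1) \<Omega>T])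
  have m: "(\<lambda>x. ?dg x + ?d x) \<in> borel_measurable (lebesgue_on T)"
    using dg(1) d by (intro borel_measurable_integrable Bochner_Integration.integrable_add)
  have m': "?dw \<in> borel_measurable (lebesgue_on T)"
    by (rule borel_measurable_lebesgue_on_AE[OF T(1) m AE])
  have "0 = (LINT x|lebesgue_on T. ?dw x)"
    using surface_energy_eq_0D[OF E f] by simp
  also have "\<dots> = (LINT x|lebesgue_on T. ?dg x + ?d x)"
    by (rule integral_cong_AE[OF m m' AE, symmetric])
  also have "\<dots> = (LINT x|lebesgue_on T. ?d x)"
    using Bochner_Integration.integral_add[OF dg(1) d] dg(2) by simp
  also have "\<dots> = (LINT x|lebesgue_on \<Omega>. 3 * (det (weak_D \<Omega> u x) - lam ^ 3))"
    by (rule integral_restrict_if(1)[OF \<Omega>(1) T(1) \<Omega>T])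
  also have "\<dots> = 3 * (LINT x|lebesgue_on \<Omega>. det (weak_D \<Omega> u x) - lam ^ 3)"
    by (rule integral_mult_right_zero)
  finally show ?thesis by simp
qed

section \<open>Pointwise lower bound for the energy density\<close>

text \<open>Orthogonal expansion around \<open>c\<close> times the identity, whose squared norm is
  \<open>3 c^2\<close>. The linear term is a trace; for \<open>A = Du\<close> and
  \<open>c = lam\<close> it is the divergence of \<open>u - g\<close> and has mean zero.\<close>

lemma norm_power2_expand:
  fixes A :: "real^3^3"
  shows "(norm A)\<^sup>2 = 3 * c\<^sup>2 + 2 * c * trace (A - c *\<^sub>R mat 1) + (norm (A - c *\<^sub>R mat 1))\<^sup>2"
proof -
  have tr: "B \<bullet> mat 1 = trace B" for B :: "real^3^3"
    by (simp add: inner_vec_def trace_def mat_def if_distrib cong: if_cong)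
  define B where "B = A - c *\<^sub>R mat 1"
  have inner: "B \<bullet> mat 1 = trace B" "mat 1 \<bullet> B = trace B" "mat 1 \<bullet> (mat 1 :: real^3^3) = 3"
    using tr[of B] tr[of "mat 1"] by (simp_all add: inner_commute trace_def mat_def)
  have "(norm A)\<^sup>2 = (B + c *\<^sub>R mat 1) \<bullet> (B + c *\<^sub>R mat 1)"
    by (simp add: B_def power2_norm_eq_inner)
  also have "\<dots> = 3 * c\<^sup>2 + 2 * c * trace B + (norm B)\<^sup>2"
    unfolding inner_add_left inner_add_right inner_scaleR_left inner_scaleR_right inner power2_norm_eq_inner
    by (simp add: power2_eq_square algebra_simps)
  finally show ?thesis by (simp add: B_def)
qed

text \<open>Beyond some \<open>t0\<close> the quotient \<open>H t / t\<close> is at least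
  \<open>1\<close>; below it \<open>t\<close> is bounded by \<open>\<bar>t0\<bar>\<close>. This
  bounds the determinant by the energy density.\<close>

lemma superlinear_bound:
  fixes H :: "real \<Rightarrow> real"
  assumes "\<And>t. t > 0 \<Longrightarrow> H t \<ge> 0" "filterlim (\<lambda>t. H t / t) at_top at_top"
  obtains C where "\<And>t. t > 0 \<Longrightarrow> t \<le> C + H t"
proof -
  have "\<forall>\<^sub>F t in at_top. H t / t \<ge> 1" using assms(2) by (simp add: filterlim_at_top)
  then obtain t0 where t0: "\<And>t. t \<ge> t0 \<Longrightarrow> H t / t \<ge> 1" by (auto simp: eventually_at_top_linorder)
  show ?thesis
  proof (rule that)
    fix t :: real assume "t > 0"
    then show "t \<le> \<bar>t0\<bar> + H t"
      using t0[of t] assms(1)[of t] by (cases "t \<ge> t0") (auto simp: field_simps)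
  qed
qed

lemma convex_tangent:
  assumes "convex_on {0<..} H" "smooth_fun_on H {0<..}" "s > (0::real)"
  obtains c :: real where "\<And>t. t > 0 \<Longrightarrow> H t \<ge> H s + c * (t - s)"
proof -
  have "Ck_on (Suc 0) H {0<..}" using assms(2) unfolding smooth_fun_on_def by blast
  then have "H differentiable (at s)" using assms(3) by simp
  then obtain c where c: "(H has_real_derivative c) (at s)" by (rule real_differentiableE)
  show ?thesis
  proof (rule that)
    fix t :: real assume "t > 0"
    then have "H t - H s \<ge> c * (t - s)"
      using assms(3) c
      by (intro convex_on_imp_above_tangent[OF assms(1)]) (auto simp: interior_open intro: has_field_derivative_at_within)
    then show "H t \<ge> H s + c * (t - s)" by simp
  qed
qed

lemma energy_lower_bound:
  assumes \<Omega>: "open \<Omega>" "bounded \<Omega>" and T: "open T" "bounded T" "closure \<Omega> \<subseteq> T"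
    and H: "\<And>t. t > 0 \<Longrightarrow> H t \<ge> 0" "smooth_fun_on H {0<..}" "convex_on {0<..} H"
      "filterlim (\<lambda>t. H t / t) at_top at_top"
    and lam: "lam > 0" and g: "g = (\<lambda>x. lam *\<^sub>R x + b)"
    and u: "u \<in> admissible_ncb \<Omega> T g M" and fin: "energy H \<Omega> u < \<infinity>"
  shows "ennreal ((LINT x|lebesgue_on \<Omega>. 3 * lam\<^sup>2 + H (lam ^ 3)) +
      (LINT x|lebesgue_on \<Omega>. (norm (weak_D \<Omega> (\<lambda>x. u x - g x) x))\<^sup>2)) \<le> energy H \<Omega> u"
proof -
  let ?M = "lebesgue_on \<Omega>"
  define D where "D = weak_D \<Omega> u"
  define V where "V = weak_D \<Omega> (\<lambda>x. u x - g x)"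
  \<comment> \<open>\<open>H\<close> is unconstrained outside \<open>{0<..}\<close>. The cut off
    \<open>h\<close> is Borel measurable and nonnegative on the whole line, and agrees with
    \<open>H\<close> at \<open>det (D x)\<close> almost everywhere.\<close>
  define h where "h t = indicator {0<..} t * H t" for t :: real
  have u': "u \<in> W12 \<Omega>" "same_boundary_values \<Omega> u g" "Linf_norm \<Omega> u \<le> ereal M"
      "AE x in ?M. det (D x) > 0" "surface_energy T (extend_by \<Omega> g u) = 0"
    using u by (auto simp: admissible_ncb_def admissible_def D_def)
  have v: "(\<lambda>x. u x - g x) \<in> W12_0 \<Omega>" using u'(2) by (simp add: same_boundary_values_def)
  have Ds: "square_integrable \<Omega> D" using u'(1) by (simp add: W12_def D_def)
  have Vs: "square_integrable \<Omega> V" using v by (simp add: W12_0_def W12_def V_def)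
  have Dm[measurable]: "D \<in> borel_measurable ?M" using Ds by (simp add: square_integrable_def)
  have const: "integrable ?M (\<lambda>_. c)" for c :: real
    by (rule integrable_lebesgue_on_continuous[OF _ \<Omega>(2,1)]) simp
  have DV: "AE x in ?M. V x = D x - lam *\<^sub>R mat 1"
  proof -
    have "has_weak_derivative \<Omega> u D" using u'(1) weak_D_works by (auto simp: W12_def D_def)
    moreover have "has_weak_derivative \<Omega> g (\<lambda>_. lam *\<^sub>R mat 1)"
      using C1_has_weak_derivative[OF \<Omega>(1) C1_affine] unfolding jacobian_affine g .
    ultimately show ?thesis
      unfolding V_def by (intro weak_D_AE_eq[OF \<Omega>(1)] has_weak_derivative_diff[OF \<Omega>(1)])
  qed
  have detm: "(\<lambda>x. det (D x)) \<in> borel_measurable ?M"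
  proof -
    have "continuous_on UNIV (\<lambda>A::real^3^3. det A)"
      unfolding det_3 by (intro continuous_intros)
    then show ?thesis by (rule borel_measurable_continuous_on[OF _ Dm])
  qed
  have "continuous_on {0<..} H"
    using H(2) unfolding smooth_fun_on_def by (metis Ck_on.simps(1))
  then have "h \<in> borel_measurable borel"
    unfolding h_def using borel_measurable_continuous_on_indicator[of "{0<..}" H] by simp
  then have hm: "(\<lambda>x. h (det (D x))) \<in> borel_measurable ?M"
    using detm by (rule measurable_compose[rotated])
  have h0: "h t \<ge> 0" for t using H(1) by (auto simp: h_def indicator_def)
  define F where "F x = (norm (D x))\<^sup>2 + h (det (D x))" for x
  have Fm: "F \<in> borel_measurable ?M" unfolding F_def using hm by measurable
  have F0: "F x \<ge> 0" for x using h0 by (simp add: F_def)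
  have EF: "energy H \<Omega> u = (\<integral>\<^sup>+ x. ennreal (F x) \<partial>?M)"
    unfolding energy_def D_def[symmetric]
  proof (rule nn_integral_cong_AE)
    show "AE x in ?M. ennreal ((norm (D x))\<^sup>2 + H (det (D x))) = ennreal (F x)"
      using u'(4) by eventually_elim (simp add: F_def h_def)
  qed
  have Fi: "integrable ?M F"
    using fin Fm F0 unfolding EF by (intro integrableI_nonneg) auto
  have Di: "integrable ?M (\<lambda>x. (norm (D x))\<^sup>2)" using Ds by (simp add: square_integrable_def)
  have Vi: "integrable ?M (\<lambda>x. (norm (V x))\<^sup>2)" using Vs by (simp add: square_integrable_def)
  have hi: "integrable ?M (\<lambda>x. h (det (D x)))"
    using Bochner_Integration.integrable_diff[OF Fi Di] by (simp add: F_def)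
  obtain C where C: "\<And>t. t > 0 \<Longrightarrow> t \<le> C + H t" using superlinear_bound[OF H(1,4)] by metis
  \<comment> \<open>The determinant is positive almost everywhere and at most
    \<open>C + h (det (D x))\<close>, which is integrable since the energy is finite and
    \<open>\<Omega>\<close> is bounded.\<close>
  have deti: "integrable ?M (\<lambda>x. det (D x))"
  proof (rule Bochner_Integration.integrable_bound[OF _ detm])
    show "integrable ?M (\<lambda>x. C + h (det (D x)))"
      using const hi by (rule Bochner_Integration.integrable_add)
    show "AE x in ?M. norm (det (D x)) \<le> norm (C + h (det (D x)))"
      using u'(4) by eventually_elim (use C in \<open>force simp: h_def\<close>)
  qed
  have det0: "(LINT x|?M. det (D x) - lam ^ 3) = 0"
    using integral_det_eq[OF \<Omega> T g u'(1-3,5)] deti by (simp add: D_def)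
  obtain c where c: "\<And>t. t > 0 \<Longrightarrow> H t \<ge> H (lam ^ 3) + c * (t - lam ^ 3)"
    using convex_tangent[OF H(3,2), of "lam ^ 3"] lam by auto
  have "integrable ?M V" by (rule square_integrable_imp_integrable[OF \<Omega> Vs])
  then have Vij: "integrable ?M (\<lambda>x. V x $ i $ j)" for i j
    by (rule integrable_bounded_linear[OF bounded_linear_entry])
  have tri: "integrable ?M (\<lambda>x. trace (V x))" unfolding trace_def using Vij by simp
  have tr0: "(LINT x|?M. trace (V x)) = 0"
    unfolding trace_def using W12_0_integral_weak_D[OF \<Omega> v] Vij
    by (simp add: Bochner_Integration.integral_sum V_def)
  \<comment> \<open>Pointwise minorant of \<open>F\<close>: the expansion of the norm around
    \<open>lam\<close> times the identity plus the tangent line of \<open>H\<close> at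
    \<open>lam ^ 3\<close>. Its trace and determinant terms integrate to zero.\<close>
  let ?G = "\<lambda>x. 3 * lam\<^sup>2 + H (lam ^ 3) + 2 * lam * trace (V x) + (norm (V x))\<^sup>2 + c * (det (D x) - lam ^ 3)"
  have deti': "integrable ?M (\<lambda>x. c * (det (D x) - lam ^ 3))"
    using deti const by (intro integrable_mult_right Bochner_Integration.integrable_diff)
  have "(LINT x|?M. ?G x) \<le> (LINT x|?M. F x)"
  proof (rule integral_mono_AE[OF _ Fi])
    show "integrable ?M ?G"
      by (intro Bochner_Integration.integrable_add const integrable_mult_right tri Vi deti')
    show "AE x in ?M. ?G x \<le> F x"
      using DV u'(4)
    proof eventually_elim
      case (elim x)
      have "h (det (D x)) = H (det (D x))" using elim(2) by (simp add: h_def)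
      then show ?case
        using c[OF elim(2)] norm_power2_expand[of "D x" lam] elim(1) by (simp add: F_def)
    qed
  qed
  also have "(LINT x|?M. ?G x) = (LINT x|?M. 3 * lam\<^sup>2 + H (lam ^ 3)) + (LINT x|?M. (norm (V x))\<^sup>2)"
  proof -
    have "(LINT x|?M. ?G x) = (LINT x|?M. 3 * lam\<^sup>2 + H (lam ^ 3)) + (LINT x|?M. 2 * lam * trace (V x)) +
        (LINT x|?M. (norm (V x))\<^sup>2) + (LINT x|?M. c * (det (D x) - lam ^ 3))"
      using const tri Vi deti' by (subst Bochner_Integration.integral_add, auto)+
    then show ?thesis using tr0 det0 by simp
  qed
  finally show ?thesis
    unfolding EF nn_integral_eq_integral[OF Fi AE_I2[OF F0]] V_def[symmetric] by (rule ennreal_leI)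
qed

lemma energy_affine:
  assumes \<Omega>: "open \<Omega>" "bounded \<Omega>" and H: "H (lam ^ 3) \<ge> 0" and g: "g = (\<lambda>x. lam *\<^sub>R x + b)"
  shows "energy H \<Omega> g = ennreal (LINT x|lebesgue_on \<Omega>. 3 * lam\<^sup>2 + H (lam ^ 3))"
proof -
  have "(norm (lam *\<^sub>R mat 1 :: real^3^3))\<^sup>2 = 3 * lam\<^sup>2"
    using norm_power2_expand[of "lam *\<^sub>R mat 1" lam] by (simp add: trace_def)
  then have "energy H \<Omega> g = (\<integral>\<^sup>+ x. ennreal (3 * lam\<^sup>2 + H (lam ^ 3)) \<partial>lebesgue_on \<Omega>)"
    unfolding energy_def g using weak_D_affine[OF \<Omega>(1), of lam b]
    by (intro nn_integral_cong_AE) (auto elim!: eventually_mono simp: det_scaled_mat)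
  also have "\<dots> = ennreal (LINT x|lebesgue_on \<Omega>. 3 * lam\<^sup>2 + H (lam ^ 3))"
    using H by (intro nn_integral_eq_integral integrable_lebesgue_on_continuous \<Omega> AE_I2) auto
  finally show ?thesis .
qed

theorem proposition5p1:
  fixes \<Omega> T :: "(real^3) set"
    and H :: "real \<Rightarrow> real"
    and M lam :: real
    and b :: "real^3"
    and g :: "real^3 \<Rightarrow> real^3"
  assumes "smooth_bounded_domain \<Omega>"
    and "smooth_bounded_domain T"
    and "closure \<Omega> \<subseteq> T"
    and "\<And>t. t > 0 \<Longrightarrow> H t \<ge> 0"
    and "smooth_fun_on H {0<..}"
    and "convex_on {0<..} H"
    and "filterlim (\<lambda>t. H t / t) at_top at_top"
    and "filterlim H at_top (at_right 0)"
    and "M > 0"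
    and "lam > 0"
    and "g = (\<lambda>x. lam *\<^sub>R x + b)"
    and "Linf_norm \<Omega> g \<le> ereal M"
  shows "(\<exists>u. is_arg_min (energy H \<Omega>) (\<lambda>v. v \<in> admissible_ncb \<Omega> T g M) u) \<and>
         (\<forall>u. is_arg_min (energy H \<Omega>) (\<lambda>v. v \<in> admissible_ncb \<Omega> T g M) u \<longrightarrow>
              (AE x in lebesgue_on \<Omega>. u x = lam *\<^sub>R x + b))"
proof -
  have \<Omega>: "open \<Omega>" "bounded \<Omega>" and T: "open T" "bounded T"
    using assms(1,2) by (auto simp: smooth_bounded_domain_def)
  have g: "g \<in> admissible_ncb \<Omega> T g M"
    by (rule affine_admissible_ncb[OF \<Omega> T assms(10-12)])
  let ?c = "LINT x|lebesgue_on \<Omega>. 3 * lam\<^sup>2 + H (lam ^ 3)"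
  let ?n = "\<lambda>u. LINT x|lebesgue_on \<Omega>. (norm (weak_D \<Omega> (\<lambda>x. u x - g x) x))\<^sup>2"
  have H: "H (lam ^ 3) \<ge> 0" using assms(4,10) by simp
  have Eg: "energy H \<Omega> g = ennreal ?c"
    by (rule energy_affine[where H=H and lam=lam, OF \<Omega> H assms(11)])
  have c0: "?c \<ge> 0" using H by simp
  \<comment> \<open>The restriction to finite energy costs nothing: \<open>g\<close> has finite
    energy, so every map with energy at most that of \<open>g\<close> satisfies it.\<close>
  have low: "ennreal (?c + ?n u) \<le> energy H \<Omega> u"
    if "u \<in> admissible_ncb \<Omega> T g M" "energy H \<Omega> u < \<infinity>" for u
    by (rule energy_lower_bound[OF \<Omega> T assms(3) assms(4-7) assms(10,11) that])
  have "is_arg_min (energy H \<Omega>) (\<lambda>v. v \<in> admissible_ncb \<Omega> T g M) g"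
    unfolding is_arg_min_def
  proof (intro conjI g notI)
    assume "\<exists>u. u \<in> admissible_ncb \<Omega> T g M \<and> energy H \<Omega> u < energy H \<Omega> g"
    then obtain u where u: "u \<in> admissible_ncb \<Omega> T g M" "energy H \<Omega> u < ennreal ?c" using Eg by auto
    then have "energy H \<Omega> u < \<infinity>" using less_trans[OF u(2)] by simp
    from low[OF u(1) this] u(2) have "ennreal (?c + ?n u) < ennreal ?c" by (rule le_less_trans)
    then show False using c0 by (simp add: ennreal_less_iff)
  qed
  moreover have "AE x in lebesgue_on \<Omega>. u x = lam *\<^sub>R x + b"
    if "is_arg_min (energy H \<Omega>) (\<lambda>v. v \<in> admissible_ncb \<Omega> T g M) u" for u
  proof -
    have u: "u \<in> admissible_ncb \<Omega> T g M" and "energy H \<Omega> u \<le> ennreal ?c"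
      using that g Eg by (auto simp: is_arg_min_def not_less)
    moreover from this have "energy H \<Omega> u < \<infinity>" using le_less_trans by fastforce
    ultimately have "ennreal (?c + ?n u) \<le> ennreal ?c" using low order_trans by blast
    then have "?n u \<le> 0" using c0 by simp
    then have n: "?n u = 0" by (intro antisym) simp_all
    have v: "(\<lambda>x. u x - g x) \<in> W12_0 \<Omega>"
      using u by (simp add: admissible_ncb_def admissible_def same_boundary_values_def)
    then have "integrable (lebesgue_on \<Omega>) (\<lambda>x. (norm (weak_D \<Omega> (\<lambda>x. u x - g x) x))\<^sup>2)"
      by (simp add: W12_0_def W12_def square_integrable_def)
    from integral_nonneg_eq_0_iff_AE[OF this] n
    have "AE x in lebesgue_on \<Omega>. weak_D \<Omega> (\<lambda>x. u x - g x) x = 0" by simp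
    from W12_0_eq_0_if_weak_D_eq_0[OF \<Omega> v this] show ?thesis
      by eventually_elim (simp add: assms(11))
  qed
  ultimately show ?thesis by blast
qed

end
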